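(* Let $\mathcal{A}$ be a balanced extensional $\mathbf{BC^{\pm}I}$-algebra (with structure elements $\mathbf{B},\mathbf{C}^+,\mathbf{C}^-,\mathbf{I},\boldsymbol{\theta}^+,\boldsymbol{\theta}^-$). Then there exists an element $\mathbf{Tr}\in\mathcal{A}$ making $\mathcal{A}$ a traced extensional $\mathbf{BC^{\pm}I}$-algebra if and only if there exist elements $\boldsymbol{\alpha},\boldsymbol{\beta}\in\mathcal{A}$ making $\mathcal{A}$ a ribbon extensional $\mathbf{BC^{\pm}I}$-algebra.
   Context: An applicative structure is a set $\mathcal{A}$ with a binary operation $(a,b)\mapsto a\,b$; application associates to the left ($a\,b\,c=(a\,b)\,c$). Given elements $\mathbf{B},\mathbf{I}$, write $a\circ b:=\mathbf{B}\,a\,b$, $a^0:=\mathbf{I}$, $a^{n+1}:=a\circ a^n$. An extensional $\mathbf{BC^{\pm}I}$-algebra is an applicative structure with elements $\mathbf{B},\mathbf{C}^+,\mathbf{C}^-,\mathbf{I}$ such that for all $a,b,c$: $\mathbf{B}\,a\,b\,c=a\,(b\,c)$; $\mathbf{C}^\star\,a\,b\,c=a\,c\,b$; $\mathbf{I}\,a=a$; $\mathbf{C}^+\,a\,b=\mathbf{C}^-\,a\,b$; $\mathbf{B}\,\mathbf{I}=\mathbf{I}$; $\mathbf{C}^\star\,\mathbf{B}\,\mathbf{I}=\mathbf{B}\,\mathbf{I}$; $(\mathbf{C}^\star\,\mathbf{B}\,\mathbf{B})\circ(\mathbf{B}\circ\mathbf{B})=(\mathbf{B}\,\mathbf{B})\circ\mathbf{B}$;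 $\mathbf{C}^\pm\circ\mathbf{C}^\mp=\mathbf{B}\,(\mathbf{B}\,\mathbf{I})$; $(\mathbf{C}^\star\,\mathbf{B}\,\mathbf{C}^\pm)\circ(\mathbf{B}\circ\mathbf{B})=(\mathbf{B}\,\mathbf{C}^\pm)\circ(\mathbf{B}\circ\mathbf{B})$; $(\mathbf{B}\,\mathbf{C}^\pm)\circ(\mathbf{C}^\pm\circ(\mathbf{B}\,\mathbf{C}^\pm))=\mathbf{C}^\pm\circ((\mathbf{B}\,\mathbf{C}^\pm)\circ\mathbf{C}^\pm)$; $(\mathbf{B}\,\mathbf{B})\circ\mathbf{C}^\pm=\mathbf{C}^\pm\circ((\mathbf{B}\,\mathbf{C}^\pm)\circ\mathbf{B})$. Here each occurrence of $\star$ ranges independently over $\{+,-\}$, and in an equation with $\pm$/$\mp$ the signs are linked, the equation being required for both choices. It is balanced if moreover there are elements $\boldsymbol{\theta}^+,\boldsymbol{\theta}^-$ with, for all $a$: $(\mathbf{B}\,\boldsymbol{\theta}^\pm)\circ\mathbf{B}=(\mathbf{C}^\star\,\mathbf{B}\,\boldsymbol{\theta}^\pm)\circ\mathbf{B}$; $\boldsymbol{\theta}^\pm\circ\boldsymbol{\theta}^\mp=\mathbf{B}\,\mathbf{I}$; $\mathbf{C}^\star\,\boldsymbol{\theta}^\star\,a=\mathbf{C}^\star\,\mathbf{I}\,a$; $\mathbf{B}\circ\boldsymbol{\theta}^\pm=\boldsymbol{\theta}^\pm\circ(\mathbf{C}^\pm\circ(\boldsymbol{\theta}^\pm\circ(\mathbf{C}^\pm\circ\mathbf{B})))$.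 A balanced extensional $\mathbf{BC^{\pm}I}$-algebra is traced if it has an element $\mathbf{Tr}$ with: $(\mathbf{C}^\star\,\mathbf{B}\,\mathbf{Tr})\circ\mathbf{B}=(\mathbf{B}\,\mathbf{Tr})\circ\mathbf{B}^2$; $(\mathbf{B}\,\mathbf{Tr})\circ((\mathbf{C}^\star\,\mathbf{B}\,\mathbf{B})\circ\mathbf{B})=\mathbf{B}\circ\mathbf{Tr}$; $\mathbf{Tr}\,\mathbf{C}^\pm=\boldsymbol{\theta}^\pm$; $\mathbf{Tr}^2\circ((\mathbf{C}^\star\,\mathbf{B}\,\mathbf{C}^-)\circ(\mathbf{B}\,\mathbf{C}^+))=\mathbf{Tr}^2$. Write $a^\bullet:=\mathbf{C}^+\,\mathbf{I}\,a$. A duality is a pair $\boldsymbol{\alpha},\boldsymbol{\beta}$ with $\boldsymbol{\alpha}^\bullet\circ\mathbf{B}=(\mathbf{B}\,\boldsymbol{\alpha})\circ\mathbf{B}^2$, $\boldsymbol{\beta}^\bullet\circ\mathbf{B}^3=\mathbf{B}\,\boldsymbol{\beta}$, $\boldsymbol{\alpha}\circ(\mathbf{B}\,\boldsymbol{\beta})=\mathbf{B}\,\mathbf{I}$, $(\mathbf{B}\,\boldsymbol{\alpha})\circ\boldsymbol{\beta}=\mathbf{B}\,\mathbf{I}$. A balanced extensional $\mathbf{BC^{\pm}I}$-algebra is ribbon if it has a duality $\boldsymbol{\alpha},\boldsymbol{\beta}$ with moreover $\boldsymbol{\alpha}\circ\boldsymbol{\theta}^\pm=\boldsymbol{\alpha}\circ(\mathbf{B}\,\boldsymbol{\theta}^\pm)$.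 *)

theory Defs
  imports Main
begin

datatype sign = Plus | Minus

primrec opp :: "sign \<Rightarrow> sign" where
  "opp Plus = Minus"
| "opp Minus = Plus"

text \<open>The underlying set of an algebra is the whole type \<open>'a\<close>. The pairs of elements with
  superscripts \<open>+\<close> and \<open>-\<close> are families indexed by \<open>sign\<close>. In the axioms below, each
  star has its own sign variable (\<open>s\<close>, \<open>s'\<close>, \<open>s''\<close>), while linked occurrences of
  plus-minus share the variable \<open>p\<close>, with \<open>opp p\<close> for minus-plus.\<close>

locale BCI_signature =
  fixes app :: "'a \<Rightarrow> 'a \<Rightarrow> 'a"  (infixl "\<cdot>" 90)
    and B :: 'a
    and C :: "sign \<Rightarrow> 'a"
    and I :: 'a
begin

definition cmp :: "'a \<Rightarrow> 'a \<Rightarrow> 'a"  (infixr "\<odot>" 80)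
  where "a \<odot> b = B \<cdot> a \<cdot> b"

primrec pow :: "'a \<Rightarrow> nat \<Rightarrow> 'a"  (infixl "\<up>" 85) where
  "a \<up> 0 = I"
| "a \<up> Suc n = a \<odot> a \<up> n"

definition bul :: "'a \<Rightarrow> 'a"
  where "bul a = C Plus \<cdot> I \<cdot> a"

end

locale extensional_BCI_algebra = BCI_signature +
  assumes B_app: "B \<cdot> a \<cdot> b \<cdot> c = a \<cdot> (b \<cdot> c)"
    and C_app: "C s \<cdot> a \<cdot> b \<cdot> c = a \<cdot> c \<cdot> b"
    and I_app: "I \<cdot> a = a"
    and C_sign: "C Plus \<cdot> a \<cdot> b = C Minus \<cdot> a \<cdot> b"
    and B_I: "B \<cdot> I = I"
    and C_B_I: "C s \<cdot> B \<cdot> I = B \<cdot> I"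
    and C_B_B: "(C s \<cdot> B \<cdot> B) \<odot> (B \<odot> B) = (B \<cdot> B) \<odot> B"
    and C_inverse: "C p \<odot> C (opp p) = B \<cdot> (B \<cdot> I)"
    and C_B_C: "(C s \<cdot> B \<cdot> C p) \<odot> (B \<odot> B) = (B \<cdot> C p) \<odot> (B \<odot> B)"
    and C_braid: "(B \<cdot> C p) \<odot> (C p \<odot> (B \<cdot> C p)) = C p \<odot> ((B \<cdot> C p) \<odot> C p)"
    and B_B_C: "(B \<cdot> B) \<odot> C p = C p \<odot> ((B \<cdot> C p) \<odot> B)"

locale balanced_extensional_BCI_algebra = extensional_BCI_algebra +
  fixes \<theta> :: "sign \<Rightarrow> 'a"
  assumes twist_central: "(B \<cdot> \<theta> p) \<odot> B = (C s \<cdot> B \<cdot> \<theta> p) \<odot> B"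
    and twist_inverse: "\<theta> p \<odot> \<theta> (opp p) = B \<cdot> I"
    and twist_app: "C s \<cdot> \<theta> s' \<cdot> a = C s'' \<cdot> I \<cdot> a"
    and twist_B: "B \<odot> \<theta> p = \<theta> p \<odot> (C p \<odot> (\<theta> p \<odot> (C p \<odot> B)))"

locale traced_extensional_BCI_algebra = balanced_extensional_BCI_algebra +
  fixes Tr :: 'a
  assumes trace_left: "(C s \<cdot> B \<cdot> Tr) \<odot> B = (B \<cdot> Tr) \<odot> B \<up> 2"
    and trace_right: "(B \<cdot> Tr) \<odot> ((C s \<cdot> B \<cdot> B) \<odot> B) = B \<odot> Tr"
    and trace_C: "Tr \<cdot> C p = \<theta> p"
    and trace_slide: "Tr \<up> 2 \<odot> ((C s \<cdot> B \<cdot> C Minus) \<odot> (B \<cdot> C Plus)) = Tr \<up> 2"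

locale duality_BCI_algebra = extensional_BCI_algebra +
  fixes \<alpha> \<beta> :: 'a
  assumes alpha_B: "bul \<alpha> \<odot> B = (B \<cdot> \<alpha>) \<odot> B \<up> 2"
    and beta_B: "bul \<beta> \<odot> B \<up> 3 = B \<cdot> \<beta>"
    and alpha_beta: "\<alpha> \<odot> (B \<cdot> \<beta>) = B \<cdot> I"
    and beta_alpha: "(B \<cdot> \<alpha>) \<odot> \<beta> = B \<cdot> I"

locale ribbon_extensional_BCI_algebra =
  balanced_extensional_BCI_algebra + duality_BCI_algebra +
  assumes alpha_twist: "\<alpha> \<odot> \<theta> p = \<alpha> \<odot> (B \<cdot> \<theta> p)"

end

theory Submission
  imports Defs
begin

text \<open>Composition makes the algebra a monoid of string diagrams, on which \<open>B\<close> acts by adding a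
  strand in front, and \<open>Tr \<cdot> f\<close> closes the first strand of \<open>f\<close>.

  Given a trace, \<open>Tr\<close> followed by a braiding is a diagram \<open>\<rho>\<close> with one input and two outputs, and a
  braiding followed by \<open>B\<close> is a diagram \<open>\<epsilon>\<close> with two inputs and one output. In a ribbon category
  these are the two halves of an isomorphism between the reflexive object and its tensor product
  with its dual, and closing the loop in \<open>\<rho> \<odot> \<rho>\<close> and \<open>\<epsilon> \<odot> \<epsilon>\<close> gives \<open>\<alpha>\<close> and \<open>\<beta>\<close>. Both zigzags
  reduce to \<open>Tr \<cdot> (\<epsilon> \<odot> \<rho>) = I\<close>. Sliding one factor \<open>\<epsilon>\<close> around the loop of \<open>\<beta>\<close>, once for each
  sign of the braiding, shows that \<open>\<beta>\<close> is compatible with the twist.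

  Conversely, a ribbon duality closes a strand with \<open>\<alpha>\<close> and the twisted and braided \<open>\<beta>\<close>. Here
  \<open>C Plus \<odot> \<theta> Plus \<odot> \<beta>\<close> and \<open>C Minus \<odot> \<theta> Minus \<odot> \<beta>\<close> agree because \<open>\<beta>\<close> absorbs the twist of two
  strands.\<close>

lemma opp_opp [simp]: "opp (opp p) = p"
  by (cases p) simp_all

section \<open>Composition, shift and points\<close>

context extensional_BCI_algebra
begin

abbreviation shift :: "'a \<Rightarrow> 'a" ("\<sigma> _" [95] 95)
  where "\<sigma> a \<equiv> B \<cdot> a"

lemma cmp_app [simp]: "(a \<odot> b) \<cdot> c = a \<cdot> (b \<cdot> c)"
  by (simp add: cmp_def B_app)

lemma cmp_I_left [simp]: "I \<odot> a = a"
  by (simp add: cmp_def B_I I_app)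

lemma cmp_I_right [simp]: "a \<odot> I = a"
  by (metis cmp_def B_I C_B_I C_app I_app)

text \<open>The point-free axiom \<open>C_B_B\<close> evaluated at two elements; most axioms are
  first turned into laws about elements in this way. Evaluating the result at a third element gives
  associativity of \<open>\<odot>\<close>.\<close>

lemma shift_cmp: "\<sigma> (a \<odot> b) = \<sigma> a \<odot> \<sigma> b"
proof -
  have "((C Plus \<cdot> B \<cdot> B) \<odot> (B \<odot> B)) \<cdot> a \<cdot> b = ((B \<cdot> B) \<odot> B) \<cdot> a \<cdot> b"
    by (simp only: C_B_B)
  then show ?thesis
    by (simp add: C_app) (simp add: cmp_def B_app)
qed

lemma cmp_assoc: "(a \<odot> b) \<odot> c = a \<odot> b \<odot> c"
proof -
  have "\<sigma> (a \<odot> b) \<cdot> c = (\<sigma> a \<odot> \<sigma> b) \<cdot> c"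
    by (simp only: shift_cmp)
  then show ?thesis
    by (simp del: shift_cmp) (simp add: cmp_def)
qed

lemma shift_inject: "\<sigma> a = \<sigma> b \<Longrightarrow> a = b"
  by (metis cmp_I_right cmp_def)

lemma cmp_ctx: "a = b \<Longrightarrow> a \<odot> c = b \<odot> c"
  by simp

lemma shift_cong: "a = b \<Longrightarrow> \<sigma> a = \<sigma> b"
  by simp

lemma C_inverse_left: "C (opp p) \<odot> C p = I"
  using C_inverse[of "opp p"] by (cases p) (simp_all add: B_I)

lemma C_inverse_right: "C p \<odot> C (opp p) = I"
  using C_inverse[of p] by (simp add: B_I)

lemma C_app_inverse: "C p \<cdot> (C (opp p) \<cdot> a) = a"
  using C_inverse_right[of p] by (metis I_app cmp_app)

lemma C_sign_any: "C s \<cdot> a \<cdot> b = C s' \<cdot> a \<cdot> b"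
  by (cases s; cases s') (simp_all add: C_sign)

lemma C_I_eq_bul: "C s \<cdot> I \<cdot> a = bul a"
  unfolding bul_def by (rule C_sign_any)

lemma bul_app: "bul a \<cdot> b = b \<cdot> a"
  by (simp add: bul_def C_app I_app)

lemma B_C_app: "B \<odot> C p \<cdot> x = C p \<cdot> (C p \<odot> \<sigma> x)"
proof -
  have "((B \<cdot> B) \<odot> C p) \<cdot> x = (C p \<odot> ((B \<cdot> C p) \<odot> B)) \<cdot> x"
    by (simp only: B_B_C)
  then show ?thesis
    by (simp add: cmp_def)
     (simp add: B_app)
qed

text \<open>Eliminates \<open>C p\<close> with two arguments in favour of points
  \<open>bul a\<close>, so that the axioms become equations between diagrams. Evaluating
  \<open>B_C_app\<close> at \<open>a\<close> and \<open>b\<close> gives \<open>*\<close>, whose case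
  \<open>y = I\<close> is the claim.\<close>

lemma C_eq_bul: "C p \<cdot> x \<cdot> a = bul a \<odot> x"
proof -
  have *: "B \<cdot> (C p \<cdot> y \<cdot> a) \<cdot> b = C p \<cdot> (y \<odot> b) \<cdot> a" for y b
  proof -
    have "(B \<odot> C p \<cdot> y) \<cdot> a \<cdot> b = C p \<cdot> (C p \<odot> \<sigma> y) \<cdot> a \<cdot> b"
      by (simp only: B_C_app)
    then show ?thesis
      by (simp add: C_app cmp_def B_app)
  qed
  from *[of I x] show ?thesis
    by (simp add: C_I_eq_bul cmp_def[symmetric])
qed

lemma C_shift: "\<sigma> (\<sigma> u) \<odot> C p = C p \<odot> \<sigma> (\<sigma> u)"
proof -
  have "((C Plus \<cdot> B \<cdot> C p) \<odot> (B \<odot> B)) \<cdot> u = ((B \<cdot> C p) \<odot> (B \<odot> B)) \<cdot> u"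
    by (simp only: C_B_C)
  then show ?thesis
    by (simp add: C_app) (simp add: cmp_def)
qed

lemma bul_shift: "bul a \<odot> \<sigma> u = u \<odot> bul a"
proof -
  have "(\<sigma> (\<sigma> u) \<odot> C Plus) \<cdot> I \<cdot> a = (C Plus \<odot> \<sigma> (\<sigma> u)) \<cdot> I \<cdot> a"
    by (simp only: C_shift)
  then have "u \<odot> bul a = C Plus \<cdot> \<sigma> u \<cdot> a"
    by (simp add: cmp_def[symmetric]) (simp add: cmp_def B_app bul_def)
  then show ?thesis
    by (simp add: C_eq_bul)
qed

lemma bul_C: "bul a \<odot> C p = \<sigma> (bul a)"
proof -
  have "(B \<odot> C p \<cdot> I) \<cdot> a = C p \<cdot> (C p \<odot> \<sigma> I) \<cdot> a"
    by (simp only: B_C_app)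
  then show ?thesis
    by (simp add: B_I C_eq_bul)
qed

lemma shift_bul_C: "\<sigma> (bul a) \<odot> C p = bul a"
  by (cases p) (use C_inverse_left[of Plus] C_inverse_left[of Minus] bul_C[of a Minus] bul_C[of a Plus]
    in \<open>metis cmp_assoc cmp_I_right opp.simps\<close>)+

lemma C_C_B: "C p \<odot> C p \<cdot> B = \<sigma> (C p \<cdot> I)"
proof -
  have "B \<odot> I = C (opp p) \<cdot> (C (opp p) \<odot> \<sigma> (C p \<cdot> I))"
    using B_C_app[of "opp p" "C p \<cdot> I"] C_app_inverse[of "opp p" I] by (cases p) auto
  then have "C p \<cdot> B = C (opp p) \<odot> \<sigma> (C p \<cdot> I)"
    using C_app_inverse[of p "C (opp p) \<odot> \<sigma> (C p \<cdot> I)"] by simp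
  then show ?thesis
    by (simp add: cmp_assoc[symmetric] C_inverse_right)
qed

text \<open>In diagrams \<open>B\<close> merges two strands by application. The rule comes from
  evaluating \<open>C_C_B\<close> at \<open>x\<close> and \<open>a\<close>; it expands
  \<open>bul\<close> of compound terms, which is how arity equations are verified.\<close>

lemma bul_of_app: "bul (x \<cdot> a) = bul a \<odot> bul x \<odot> B"
proof -
  have "(C Plus \<odot> C Plus \<cdot> B) \<cdot> x \<cdot> a = \<sigma> (C Plus \<cdot> I) \<cdot> x \<cdot> a"
    by (simp only: C_C_B)
  then show ?thesis
    by (simp add: C_eq_bul B_app)
qed

lemma bul_I_B: "bul I \<odot> B = I"
  using C_B_I[of Plus] by (simp add: C_eq_bul B_I)

lemma bul_B: "bul B \<odot> B \<odot> B \<odot> B = \<sigma> B \<odot> B"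
  using C_B_B[of Plus] by (simp add: C_eq_bul cmp_assoc)

lemma B_shift: "B \<odot> \<sigma> a = \<sigma> (\<sigma> a) \<odot> B"
proof -
  have "(bul B \<odot> B \<odot> B \<odot> B) \<cdot> a = (\<sigma> B \<odot> B) \<cdot> a"
    by (simp only: bul_B)
  then show ?thesis
    by (simp add: bul_app) (simp add: cmp_def)
qed

section \<open>Arities and the interchange law\<close>

text \<open>Read \<open>f \<odot> g\<close> as a string diagram in which \<open>f\<close> comes first; \<open>\<sigma> f\<close> is \<open>f\<close> with one
  more strand in front. The predicate says that \<open>f\<close> uses only its first \<open>n\<close> inputs and turns
  them into \<open>m\<close> outputs; the paper writes this as an arrow from \<open>m\<close> to \<open>n\<close> of the
  internal PRO.\<close>

definition arity :: "nat \<Rightarrow> nat \<Rightarrow> 'a \<Rightarrow> bool"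
  where "arity n m f \<longleftrightarrow> bul f \<odot> B \<up> Suc n = \<sigma> f \<odot> B \<up> m"

lemma pow_Suc_right: "a \<up> Suc n = a \<up> n \<odot> a"
proof (induction n)
  case (Suc n)
  then show ?case
    by (metis cmp_assoc pow.simps(2))
qed simp

lemma B_pow_I: "(B \<up> n) \<cdot> I = I"
  by (induction n) (simp_all add: I_app B_I)

lemma arityI: "bul f \<odot> B \<odot> B \<up> n = \<sigma> f \<odot> B \<up> m \<Longrightarrow> arity n m f"
  by (simp add: arity_def)

lemma arityD: "arity n m f \<Longrightarrow> bul f \<odot> B \<odot> B \<up> n = \<sigma> f \<odot> B \<up> m"
  by (simp add: arity_def)

text \<open>As \<open>f \<odot> g\<close> is \<open>B \<cdot> f \<cdot> g\<close>, two uses of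
  \<open>bul_of_app\<close> expose \<open>bul B\<close>, which \<open>bul_B\<close> turns into a
  shift; then the arity equations of \<open>f\<close> and \<open>g\<close> apply one after the
  other.\<close>

lemma arity_cmp:
  assumes "arity n m f" "arity m k g"
  shows "arity n k (f \<odot> g)"
proof (rule arityI)
  have "bul (f \<odot> g) = bul g \<odot> bul f \<odot> bul B \<odot> B \<odot> B"
    by (simp add: cmp_def[of f g] bul_of_app cmp_assoc)
  then have "bul (f \<odot> g) \<odot> B \<odot> B \<up> n = bul g \<odot> bul f \<odot> (bul B \<odot> B \<odot> B \<odot> B) \<odot> B \<up> n"
    by (simp add: cmp_assoc)
  also have "\<dots> = bul g \<odot> (bul f \<odot> \<sigma> B) \<odot> B \<odot> B \<up> n"
    by (simp add: bul_B cmp_assoc)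
  also have "\<dots> = bul g \<odot> B \<odot> (bul f \<odot> B \<odot> B \<up> n)"
    by (simp add: bul_shift cmp_assoc)
  also have "\<dots> = bul g \<odot> (B \<odot> \<sigma> f) \<odot> B \<up> m"
    by (simp add: arityD[OF assms(1)] cmp_assoc)
  also have "\<dots> = (bul g \<odot> \<sigma> (\<sigma> f)) \<odot> B \<odot> B \<up> m"
    by (simp add: B_shift cmp_assoc)
  also have "\<dots> = \<sigma> f \<odot> (bul g \<odot> B \<odot> B \<up> m)"
    by (simp add: bul_shift cmp_assoc)
  also have "\<dots> = \<sigma> (f \<odot> g) \<odot> B \<up> k"
    by (simp add: arityD[OF assms(2)] shift_cmp cmp_assoc)
  finally show "bul (f \<odot> g) \<odot> B \<odot> B \<up> n = \<sigma> (f \<odot> g) \<odot> B \<up> k" .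
qed

lemma arity_shift:
  assumes "arity n m f"
  shows "arity (Suc n) (Suc m) (\<sigma> f)"
proof (rule arityI)
  have "bul (\<sigma> f) \<odot> B \<odot> B \<up> Suc n = bul f \<odot> (bul B \<odot> B \<odot> B \<odot> B) \<odot> B \<up> n"
    by (simp add: bul_of_app cmp_assoc)
  also have "\<dots> = (bul f \<odot> \<sigma> B) \<odot> B \<odot> B \<up> n"
    by (simp add: bul_B cmp_assoc)
  also have "\<dots> = B \<odot> (bul f \<odot> B \<odot> B \<up> n)"
    by (simp add: bul_shift cmp_assoc)
  also have "\<dots> = (B \<odot> \<sigma> f) \<odot> B \<up> m"
    by (simp add: arityD[OF assms] cmp_assoc)
  finally show "bul (\<sigma> f) \<odot> B \<odot> B \<up> Suc n = \<sigma> (\<sigma> f) \<odot> B \<up> Suc m"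
    by (simp add: B_shift cmp_assoc)
qed

lemma arity_Suc:
  assumes "arity n m f"
  shows "arity (Suc n) (Suc m) f"
  using cmp_ctx[OF arityD[OF assms], of B]
  by (intro arityI) (simp only: cmp_assoc pow_Suc_right)

lemma arity_add: "arity n m f \<Longrightarrow> arity (n + k) (m + k) f"
  by (induction k) (simp_all add: arity_Suc)

text \<open>The arity equation evaluated at \<open>x\<close>. Since
  \<open>(B \<up> n) \<cdot> x\<close> is \<open>x\<close> behind \<open>n\<close> strands, this is
  the interchange law of a monoidal category.\<close>

lemma arity_interchange:
  assumes "arity n m f"
  shows "f \<odot> (B \<up> m) \<cdot> x = (B \<up> n) \<cdot> x \<odot> f"
proof -
  have "(bul f \<odot> B \<odot> B \<up> n) \<cdot> x = (\<sigma> f \<odot> B \<up> m) \<cdot> x"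
    by (simp only: arityD[OF assms])
  then show ?thesis
    by (simp add: bul_app) (simp add: cmp_def)
qed

lemma arity_B: "arity 2 1 B"
  using bul_B by (intro arityI) (simp add: numeral_2_eq_2)

lemma arity_C: "arity 2 2 (C p)"
  using C_B_C[of Plus p] by (intro arityI) (simp add: numeral_2_eq_2 C_eq_bul cmp_assoc)

lemma arity_bul: "arity 0 1 (bul a)"
proof (rule arityI)
  have "bul (bul a) = bul a \<odot> (bul I \<odot> bul (C Plus) \<odot> B) \<odot> B"
    by (simp add: bul_def[of a] bul_of_app)
  then have "bul (bul a) \<odot> B \<odot> B \<up> 0 = bul a \<odot> bul I \<odot> (bul (C Plus) \<odot> B \<odot> B \<odot> B)"
    by (simp add: cmp_assoc)
  also have "\<dots> = bul a \<odot> (bul I \<odot> \<sigma> (C Plus)) \<odot> B \<odot> B"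
    using arityD[OF arity_C[of Plus]] by (simp add: numeral_2_eq_2 cmp_assoc)
  also have "\<dots> = (bul a \<odot> C Plus) \<odot> (bul I \<odot> B) \<odot> B"
    by (simp add: bul_shift cmp_assoc)
  finally show "bul (bul a) \<odot> B \<odot> B \<up> 0 = \<sigma> (bul a) \<odot> B \<up> 1"
    by (simp add: bul_I_B bul_C)
qed

text \<open>With a single output, \<open>w\<close> is recovered from the element
  \<open>w \<cdot> I\<close> by \<open>*\<close>, and \<open>B \<cdot> I = I\<close> makes this
  element insensitive to a trailing \<open>B\<close>.\<close>

lemma arity_eta:
  assumes "arity n 1 u" "arity n 1 v" "u \<odot> B = v \<odot> B"
  shows "u = v"
proof -
  have *: "w = bul (w \<cdot> I) \<odot> B \<up> n" if "arity n 1 w" for w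
  proof -
    have "bul (w \<cdot> I) \<odot> B \<up> n = bul I \<odot> (bul w \<odot> B \<odot> B \<up> n)"
      by (simp add: bul_of_app cmp_assoc)
    also have "\<dots> = (bul I \<odot> \<sigma> w) \<odot> B"
      by (simp add: arityD[OF that] cmp_assoc)
    also have "\<dots> = w"
      by (simp add: bul_shift cmp_assoc bul_I_B)
    finally show ?thesis ..
  qed
  have "(u \<odot> B) \<cdot> I = (v \<odot> B) \<cdot> I"
    by (simp only: assms(3))
  then have "u \<cdot> I = v \<cdot> I"
    by (simp add: B_I)
  with *[OF assms(1)] *[OF assms(2)] show ?thesis
    by simp
qed

section \<open>Naturality of the braiding\<close>

text \<open>\<open>braid p n\<close> moves the first strand past the next \<open>n\<close>; \<open>braid' p n\<close> moves it back by
  crossings of sign \<open>p\<close>, so it is the inverse of \<open>braid (opp p) n\<close>.\<close>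

primrec braid :: "sign \<Rightarrow> nat \<Rightarrow> 'a" where
  "braid p 0 = I"
| "braid p (Suc n) = C p \<odot> \<sigma> (braid p n)"

lemma braid_B_pow: "\<sigma> (B \<up> n) \<odot> C p = braid p (Suc n) \<odot> B \<up> n"
proof (induction n)
  case 0
  then show ?case by (simp add: B_I)
next
  case (Suc n)
  have "\<sigma> (B \<up> Suc n) \<odot> C p = \<sigma> B \<odot> (\<sigma> (B \<up> n) \<odot> C p)"
    by (simp add: shift_cmp cmp_assoc)
  also have "\<dots> = (\<sigma> B \<odot> C p) \<odot> \<sigma> (braid p n) \<odot> B \<up> n"
    by (simp add: Suc cmp_assoc)
  also have "\<dots> = C p \<odot> \<sigma> (C p) \<odot> (B \<odot> \<sigma> (braid p n)) \<odot> B \<up> n"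
    by (simp add: B_B_C cmp_assoc)
  finally show ?case
    by (simp add: B_shift shift_cmp cmp_assoc)
qed

lemma C_cancel: "C p \<odot> a = C p \<odot> b \<Longrightarrow> a = b"
  by (metis C_inverse_left cmp_I_left cmp_assoc)

text \<open>The diagram \<open>\<sigma> (bul f \<odot> B \<up> Suc n) \<odot> C p\<close> is
  computed twice: by moving the crossing through \<open>B \<up> Suc n\<close> and the point, and
  after rewriting by the arity equation. Cancelling \<open>C p\<close> and evaluating at
  \<open>I\<close>, which \<open>B \<up> m\<close> fixes, leaves the claim.\<close>

lemma braid_natural:
  assumes "arity n m f"
  shows "braid p n \<odot> f = \<sigma> f \<odot> braid p m"
proof -
  let ?b = "braid p"
  have "\<sigma> (bul f \<odot> B \<up> Suc n) \<odot> C p = \<sigma> (bul f) \<odot> (\<sigma> (B \<up> Suc n) \<odot> C p)"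
    by (simp only: shift_cmp cmp_assoc)
  also have "\<dots> = (\<sigma> (bul f) \<odot> C p) \<odot> \<sigma> (?b (Suc n)) \<odot> B \<up> Suc n"
    by (simp only: braid_B_pow braid.simps(2)[of _ "Suc n"] cmp_assoc)
  also have "\<dots> = (bul f \<odot> \<sigma> (?b (Suc n))) \<odot> B \<up> Suc n"
    by (simp only: shift_bul_C cmp_assoc)
  also have "\<dots> = ?b (Suc n) \<odot> (bul f \<odot> B \<up> Suc n)"
    by (simp only: bul_shift cmp_assoc)
  also have "\<dots> = ?b (Suc n) \<odot> \<sigma> f \<odot> B \<up> m"
    by (simp only: assms[unfolded arity_def])
  finally have 1: "\<sigma> (bul f \<odot> B \<up> Suc n) \<odot> C p = ?b (Suc n) \<odot> \<sigma> f \<odot> B \<up> m" .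
  have "\<sigma> (bul f \<odot> B \<up> Suc n) \<odot> C p = \<sigma> (\<sigma> f) \<odot> (\<sigma> (B \<up> m) \<odot> C p)"
    by (simp only: assms[unfolded arity_def] shift_cmp cmp_assoc)
  also have "\<dots> = (\<sigma> (\<sigma> f) \<odot> C p) \<odot> \<sigma> (?b m) \<odot> B \<up> m"
    by (simp only: braid_B_pow braid.simps(2) cmp_assoc)
  also have "\<dots> = C p \<odot> \<sigma> (\<sigma> f) \<odot> \<sigma> (?b m) \<odot> B \<up> m"
    by (simp only: C_shift cmp_assoc)
  finally have "C p \<odot> \<sigma> (?b n \<odot> f) \<odot> B \<up> m = C p \<odot> \<sigma> (\<sigma> f \<odot> ?b m) \<odot> B \<up> m"
    using 1 by (simp only: shift_cmp cmp_assoc braid.simps(2))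
  then have "(\<sigma> (?b n \<odot> f) \<odot> B \<up> m) \<cdot> I = (\<sigma> (\<sigma> f \<odot> ?b m) \<odot> B \<up> m) \<cdot> I"
    using C_cancel by metis
  then show ?thesis
    by (simp add: B_pow_I) (simp add: cmp_def[symmetric])
qed

text \<open>Composites are kept right-nested, so a cancelling pair may be followed by a further
  factor or lie under a shift, and each case needs its own rewrite rule. The pattern with
  \<open>cmp_ctx\<close> recurs below for the same reason.\<close>

lemmas C_cancel_simps =
  C_inverse_left C_inverse_right
  C_inverse_left[THEN cmp_ctx, unfolded cmp_assoc cmp_I_left]
  C_inverse_right[THEN cmp_ctx, unfolded cmp_assoc cmp_I_left]
  C_inverse_left[THEN shift_cong, unfolded shift_cmp B_I]
  C_inverse_right[THEN shift_cong, unfolded shift_cmp B_I]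
  C_inverse_left[THEN shift_cong, THEN cmp_ctx, unfolded shift_cmp B_I cmp_assoc cmp_I_left]
  C_inverse_right[THEN shift_cong, THEN cmp_ctx, unfolded shift_cmp B_I cmp_assoc cmp_I_left]

primrec braid' :: "sign \<Rightarrow> nat \<Rightarrow> 'a" where
  "braid' p 0 = I"
| "braid' p (Suc n) = \<sigma> (braid' p n) \<odot> C p"

lemma braid'_braid: "braid' p n \<odot> braid (opp p) n = I"
proof (induction n)
  case (Suc n)
  have "braid' p (Suc n) \<odot> braid (opp p) (Suc n) = \<sigma> (braid' p n \<odot> braid (opp p) n)"
    by (simp add: cmp_assoc C_cancel_simps shift_cmp)
  then show ?case
    by (simp add: Suc B_I)
qed simp

lemma braid_braid': "braid p n \<odot> braid' (opp p) n = I"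
proof (induction n)
  case (Suc n)
  have "braid p (Suc n) \<odot> braid' (opp p) (Suc n) = C p \<odot> \<sigma> (braid p n \<odot> braid' (opp p) n) \<odot> C (opp p)"
    by (simp add: cmp_assoc shift_cmp)
  then show ?case
    by (simp add: Suc B_I C_inverse_right)
qed simp

lemma braid'_natural:
  assumes "arity n m f"
  shows "f \<odot> braid' p m = braid' p n \<odot> \<sigma> f"
proof -
  have "f \<odot> braid' p m = braid' p n \<odot> (braid (opp p) n \<odot> f) \<odot> braid' p m"
    by (simp add: cmp_assoc[symmetric] braid'_braid)
  also have "\<dots> = braid' p n \<odot> \<sigma> f \<odot> (braid (opp p) m \<odot> braid' p m)"
    by (simp add: braid_natural[OF assms] cmp_assoc)
  finally show ?thesis
    using braid_braid'[of "opp p" m] by simp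
qed

lemma braid_1_2:
  "braid p (Suc 0) = C p" "braid p 2 = C p \<odot> \<sigma> (C p)"
  "braid' p (Suc 0) = C p" "braid' p 2 = \<sigma> (C p) \<odot> C p"
  by (simp_all add: numeral_2_eq_2 B_I)

lemma C_commute: "C p \<odot> C q = C q \<odot> C p"
  by (cases p; cases q) (use C_inverse_left[of Plus] C_inverse_left[of Minus] in simp_all)

lemma braid_rule: "\<sigma> (C p) \<odot> C p \<odot> \<sigma> (C p) = C p \<odot> \<sigma> (C p) \<odot> C p"
  by (rule C_braid)

lemma braid_rule_inverse:
  "\<sigma> (C p) \<odot> C p \<odot> \<sigma> (C (opp p)) = C (opp p) \<odot> \<sigma> (C p) \<odot> C p"
proof -
  have "C p \<odot> \<sigma> (C p) \<odot> C p \<odot> \<sigma> (C (opp p))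
      = (\<sigma> (C p) \<odot> C p \<odot> \<sigma> (C p)) \<odot> \<sigma> (C (opp p))"
    by (simp only: braid_rule cmp_assoc)
  also have "\<dots> = C p \<odot> C (opp p) \<odot> \<sigma> (C p) \<odot> C p"
    by (simp add: cmp_assoc C_cancel_simps)
  finally show ?thesis
    by (rule C_cancel)
qed

text \<open>One zigzag is inserted, \<open>t\<close> moves across one of its halves by hypothesis
  and past the rest by interchange, and the other zigzag is straightened. Both constructions use
  this to pass between \<open>\<alpha>\<close> and \<open>\<beta>\<close>.\<close>

lemma arity_twist_transfer:
  assumes \<alpha>: "arity 0 2 \<alpha>" and \<beta>: "arity 2 0 \<beta>"
    and zigzag: "\<alpha> \<odot> \<sigma> \<beta> = I" "\<sigma> \<alpha> \<odot> \<beta> = I" and t: "arity 1 1 t"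
  shows "\<alpha> \<odot> t = \<alpha> \<odot> \<sigma> t \<longleftrightarrow> t \<odot> \<beta> = \<sigma> t \<odot> \<beta>"
proof
  have \<alpha>x: "\<alpha> \<odot> \<sigma> (\<sigma> x) = x \<odot> \<alpha>" for x
    using arity_interchange[OF \<alpha>, of x] by (simp add: numeral_2_eq_2 I_app)
  have \<beta>x: "\<sigma> (\<sigma> x) \<odot> \<beta> = \<beta> \<odot> x" for x
    using arity_interchange[OF \<beta>, of x] by (simp add: numeral_2_eq_2 I_app)
  have tx: "\<sigma> x \<odot> t = t \<odot> \<sigma> x" for x
    using arity_interchange[OF t, of x] by (simp add: I_app)
  {
    assume *: "\<alpha> \<odot> t = \<alpha> \<odot> \<sigma> t"
    have "\<sigma> t \<odot> \<beta> = \<sigma> (\<alpha> \<odot> \<sigma> \<beta>) \<odot> \<sigma> t \<odot> \<beta>"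
      by (simp add: zigzag B_I)
    also have "\<dots> = \<sigma> \<alpha> \<odot> \<sigma> (\<sigma> \<beta> \<odot> t) \<odot> \<beta>"
      by (simp add: shift_cmp cmp_assoc)
    also have "\<dots> = \<sigma> (\<alpha> \<odot> t) \<odot> \<sigma> (\<sigma> \<beta>) \<odot> \<beta>"
      by (simp only: tx shift_cmp cmp_assoc)
    also have "\<dots> = (\<sigma> \<alpha> \<odot> \<beta>) \<odot> t \<odot> \<beta>"
      by (simp only: * shift_cmp \<beta>x \<beta>x[THEN cmp_ctx, unfolded cmp_assoc] cmp_assoc)
    finally show "t \<odot> \<beta> = \<sigma> t \<odot> \<beta>"
      by (simp add: zigzag)
  next
    assume *: "t \<odot> \<beta> = \<sigma> t \<odot> \<beta>"
    have "\<alpha> \<odot> \<sigma> t = \<alpha> \<odot> \<sigma> t \<odot> \<sigma> (\<sigma> \<alpha> \<odot> \<beta>)"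
      by (simp add: zigzag B_I)
    also have "\<dots> = \<alpha> \<odot> \<sigma> (t \<odot> \<sigma> \<alpha>) \<odot> \<sigma> \<beta>"
      by (simp only: shift_cmp cmp_assoc)
    also have "\<dots> = (\<alpha> \<odot> \<sigma> (\<sigma> \<alpha>)) \<odot> \<sigma> (t \<odot> \<beta>)"
      by (simp only: tx[symmetric] shift_cmp cmp_assoc)
    also have "\<dots> = (\<alpha> \<odot> t) \<odot> \<alpha> \<odot> \<sigma> \<beta>"
      by (simp only: * shift_cmp \<alpha>x \<alpha>x[THEN cmp_ctx, unfolded cmp_assoc] cmp_assoc)
    finally show "\<alpha> \<odot> t = \<alpha> \<odot> \<sigma> t"
      by (simp add: zigzag)
  }
qed

end

section \<open>Naturality of the twist\<close>

context balanced_extensional_BCI_algebra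
begin

lemma arity_twist: "arity 1 1 (\<theta> p)"
  using twist_central[of p Plus] by (intro arityI) (simp add: C_eq_bul cmp_assoc)

lemma twist_cancel: "\<theta> p \<odot> \<theta> (opp p) = I" "\<theta> (opp p) \<odot> \<theta> p = I"
  using twist_inverse[of p] twist_inverse[of "opp p"] by (simp_all add: B_I)

lemmas twist_cancel_simps =
  twist_cancel
  twist_cancel[THEN cmp_ctx, unfolded cmp_assoc cmp_I_left]
  twist_cancel[THEN shift_cong, unfolded shift_cmp B_I]
  twist_cancel[THEN shift_cong, THEN cmp_ctx, unfolded shift_cmp B_I cmp_assoc cmp_I_left]

lemma bul_twist: "bul a \<odot> \<theta> p = bul a"
  using twist_app[of Plus p a Plus] by (simp add: C_eq_bul)

lemma C_twist: "C q \<odot> \<theta> p = \<sigma> (\<theta> p) \<odot> C q"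
  using braid_natural[OF arity_twist, of q p] by (simp add: braid_1_2 B_I)

lemma twist_C: "\<theta> p \<odot> C q = C q \<odot> \<sigma> (\<theta> p)"
  using braid'_natural[OF arity_twist, of p q] by (simp add: braid_1_2 B_I)

lemma twist_shift: "\<theta> p \<odot> \<sigma> x = \<sigma> x \<odot> \<theta> p"
  using arity_interchange[OF arity_twist, of p x] by (simp add: I_app)

end


section \<open>The calculus of traces\<close>

context traced_extensional_BCI_algebra
begin

lemma arity_Tr: "arity 1 2 Tr"
  using trace_left[of Plus] by (intro arityI) (simp add: C_eq_bul cmp_assoc)

text \<open>Comes from evaluating \<open>trace_right\<close> at \<open>x\<close>. It splits a loop
  into its opening \<open>Tr\<close> and its closing \<open>B\<close>, which can then be moved
  separately.\<close>

lemma Tr_shift: "Tr \<odot> \<sigma> x \<odot> B = \<sigma> (Tr \<cdot> x)"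
proof -
  have "((B \<cdot> Tr) \<odot> ((C Plus \<cdot> B \<cdot> B) \<odot> B)) \<cdot> x = (B \<odot> Tr) \<cdot> x"
    by (simp only: trace_right)
  then show ?thesis
    by (simp add: C_app) (simp add: cmp_def)
qed

lemma trace_natural_left: "Tr \<cdot> (\<sigma> v \<odot> x) = v \<odot> Tr \<cdot> x"
proof -
  have "(Tr \<odot> \<sigma> (\<sigma> v)) \<cdot> x = (\<sigma> v \<odot> Tr) \<cdot> x"
    using arity_interchange[OF arity_Tr, of v] by (simp add: I_app numeral_2_eq_2)
  then show ?thesis
    by simp (simp add: cmp_def)
qed

lemma trace_natural_right: "Tr \<cdot> (x \<odot> \<sigma> v) = (Tr \<cdot> x) \<odot> v"
proof -
  have "(Tr \<odot> \<sigma> x \<odot> B) \<cdot> v = \<sigma> (Tr \<cdot> x) \<cdot> v"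
    by (simp only: Tr_shift)
  then show ?thesis
    by simp (simp add: cmp_def)
qed

text \<open>\<open>trace_slide\<close> conjugates by one fixed pair of signs only. Choosing
  \<open>y\<close> so that one of the two crossings cancels gives the slide for either sign.\<close>

lemma trace_slide_C: "Tr \<cdot> (Tr \<cdot> (C p \<odot> x)) = Tr \<cdot> (Tr \<cdot> (x \<odot> C p))"
proof -
  have *: "Tr \<cdot> (Tr \<cdot> (C Plus \<odot> y \<odot> C Minus)) = Tr \<cdot> (Tr \<cdot> y)" for y
  proof -
    have "(Tr \<up> 2 \<odot> ((C Plus \<cdot> B \<cdot> C Minus) \<odot> (B \<cdot> C Plus))) \<cdot> y = (Tr \<up> 2) \<cdot> y"
      by (simp only: trace_slide)
    then show ?thesis
      by (simp add: C_app numeral_2_eq_2 I_app cmp_def[symmetric] cmp_assoc)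
  qed
  show ?thesis
  proof (cases p)
    case Plus
    then show ?thesis
      using *[of "x \<odot> C Plus"] C_inverse_right[of Plus] by (simp add: cmp_assoc)
  next
    case Minus
    then show ?thesis
      using *[of "C Minus \<odot> x"] C_inverse_right[of Plus]
      by (simp add: cmp_assoc[symmetric])
  qed
qed

text \<open>The superposing law with the idle strand in front, which the traced strand crosses
  before and after \<open>x\<close>. Once \<open>Tr_shift\<close> has split the loop,
  \<open>1\<close> and \<open>2\<close> carry its two ends across the idle strand. That rule only
  computes shifted traces, hence the final \<open>shift_inject\<close>.\<close>

lemma trace_conj_C: "Tr \<cdot> (C p \<odot> \<sigma> x \<odot> C (opp p)) = \<sigma> (Tr \<cdot> x)"
proof -
  let ?C = "C p" and ?D = "C (opp p)"
  have 1: "Tr \<odot> \<sigma> ?C = ?C \<odot> \<sigma> Tr \<odot> ?D"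
  proof -
    have "Tr \<odot> \<sigma> ?C = ?C \<odot> (?D \<odot> Tr) \<odot> \<sigma> ?C"
      by (simp only: cmp_assoc C_cancel_simps)
    also have "?D \<odot> Tr = \<sigma> Tr \<odot> ?D \<odot> \<sigma> ?D"
      using braid_natural[OF arity_Tr, of "opp p"] by (simp add: braid_1_2 B_I)
    finally show ?thesis
      by (simp only: cmp_assoc C_cancel_simps cmp_I_right)
  qed
  have 2: "\<sigma> ?D \<odot> B = ?C \<odot> \<sigma> B \<odot> ?D"
  proof (rule C_cancel)
    show "?D \<odot> \<sigma> ?D \<odot> B = ?D \<odot> ?C \<odot> \<sigma> B \<odot> ?D"
      using braid_natural[OF arity_B, of "opp p"]
      by (simp add: C_cancel_simps braid_1_2 B_I cmp_assoc)
  qed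
  have "\<sigma> (Tr \<cdot> (?C \<odot> \<sigma> x \<odot> ?D)) = (Tr \<odot> \<sigma> ?C) \<odot> \<sigma> (\<sigma> x) \<odot> \<sigma> ?D \<odot> B"
    by (simp only: Tr_shift[symmetric] shift_cmp cmp_assoc)
  also have "\<dots> = ?C \<odot> \<sigma> Tr \<odot> ?D \<odot> (\<sigma> (\<sigma> x) \<odot> ?C) \<odot> \<sigma> B \<odot> ?D"
    by (simp only: 1 2 cmp_assoc)
  also have "\<dots> = ?C \<odot> \<sigma> (Tr \<odot> \<sigma> x \<odot> B) \<odot> ?D"
    by (simp only: C_shift shift_cmp cmp_assoc C_cancel_simps)
  also have "\<dots> = \<sigma> (\<sigma> (Tr \<cdot> x))"
    by (simp only: Tr_shift C_shift[symmetric] C_shift[THEN cmp_ctx, symmetric, unfolded cmp_assoc]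
        C_cancel_simps cmp_I_right)
  finally show ?thesis
    by (rule shift_inject)
qed

lemma arity_trace:
  assumes "arity (Suc n) (Suc m) f"
  shows "arity n m (Tr \<cdot> f)"
proof (rule arityI)
  have "bul (Tr \<cdot> f) \<odot> B \<odot> B \<up> n = bul f \<odot> (bul Tr \<odot> B \<odot> B) \<odot> B \<up> n"
    by (simp add: bul_of_app cmp_assoc)
  also have "\<dots> = (bul f \<odot> \<sigma> Tr) \<odot> B \<odot> B \<odot> B \<up> n"
    using arityD[OF arity_Tr] by (simp add: numeral_2_eq_2 cmp_assoc)
  also have "\<dots> = Tr \<odot> (bul f \<odot> B \<odot> B \<up> Suc n)"
    by (simp add: bul_shift cmp_assoc)
  also have "\<dots> = (Tr \<odot> \<sigma> f \<odot> B) \<odot> B \<up> m"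
    by (simp only: arityD[OF assms]) (simp add: cmp_assoc)
  finally show "bul (Tr \<cdot> f) \<odot> B \<odot> B \<up> n = \<sigma> (Tr \<cdot> f) \<odot> B \<up> m"
    by (simp only: Tr_shift)
qed

section \<open>The duality defined by a trace\<close>

definition \<rho> :: 'a where "\<rho> = Tr \<odot> C Plus"

definition \<epsilon> :: 'a where "\<epsilon> = C Minus \<odot> B"

lemma arity_\<rho>: "arity 1 2 \<rho>"
  unfolding \<rho>_def by (rule arity_cmp[OF arity_Tr arity_C])

lemma arity_\<epsilon>: "arity 2 1 \<epsilon>"
  unfolding \<epsilon>_def by (rule arity_cmp[OF arity_C arity_B])

lemma \<rho>_shift: "\<rho> \<odot> \<sigma> (\<sigma> x) = \<sigma> x \<odot> \<rho>"
  using arity_interchange[OF arity_\<rho>, of x] by (simp add: numeral_2_eq_2 I_app)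

lemma \<epsilon>_shift: "\<epsilon> \<odot> \<sigma> x = \<sigma> (\<sigma> x) \<odot> \<epsilon>"
  using arity_interchange[OF arity_\<epsilon>, of x] by (simp add: numeral_2_eq_2 I_app)

lemma C_\<rho>: "C p \<odot> \<rho> = \<sigma> \<rho> \<odot> C p \<odot> \<sigma> (C p)"
  using braid_natural[OF arity_\<rho>, of p] by (simp add: braid_1_2 B_I)

lemma \<rho>_C: "\<rho> \<odot> \<sigma> (C p) \<odot> C p = C p \<odot> \<sigma> \<rho>"
  using braid'_natural[OF arity_\<rho>, of p] by (simp add: braid_1_2 B_I)

lemma C_\<epsilon>: "C p \<odot> \<sigma> (C p) \<odot> \<epsilon> = \<sigma> \<epsilon> \<odot> C p"
  using braid_natural[OF arity_\<epsilon>, of p] by (simp add: braid_1_2 B_I cmp_assoc)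

lemma \<epsilon>_C: "\<epsilon> \<odot> C p = \<sigma> (C p) \<odot> C p \<odot> \<sigma> \<epsilon>"
  using braid'_natural[OF arity_\<epsilon>, of p] by (simp add: braid_1_2 B_I cmp_assoc)

text \<open>Braid moves bring \<open>Tr\<close> and \<open>B\<close> to the two sides of a single
  shifted \<open>C Plus\<close>; \<open>Tr_shift\<close> closes this loop, and its value is the
  twist.\<close>

lemma \<rho>_\<epsilon>: "\<sigma> \<rho> \<odot> C Plus \<odot> \<sigma> \<epsilon> = \<theta> Plus"
proof -
  have 1: "\<sigma> Tr \<odot> C Minus = C Minus \<odot> Tr \<odot> \<sigma> (C Plus)"
  proof -
    have "\<sigma> Tr \<odot> C Minus = (\<sigma> Tr \<odot> C Minus \<odot> \<sigma> (C Minus)) \<odot> \<sigma> (C Plus)"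
      using C_cancel_simps[of Plus] by (simp add: cmp_assoc)
    also have "\<sigma> Tr \<odot> C Minus \<odot> \<sigma> (C Minus) = C Minus \<odot> Tr"
      using braid_natural[OF arity_Tr, of Minus] by (simp add: braid_1_2 B_I)
    finally show ?thesis
      by (simp only: cmp_assoc)
  qed
  have 2: "\<sigma> (C Plus) \<odot> C Plus \<odot> \<sigma> B = B \<odot> C Plus"
    using braid'_natural[OF arity_B, of Plus] by (simp add: braid_1_2 B_I cmp_assoc)
  have "\<sigma> \<rho> \<odot> C Plus \<odot> \<sigma> \<epsilon> = \<sigma> Tr \<odot> (\<sigma> (C Plus) \<odot> C Plus \<odot> \<sigma> (C Minus)) \<odot> \<sigma> B"
    by (simp only: \<rho>_def \<epsilon>_def shift_cmp cmp_assoc)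
  also have "\<dots> = (\<sigma> Tr \<odot> C Minus) \<odot> \<sigma> (C Plus) \<odot> C Plus \<odot> \<sigma> B"
    using braid_rule_inverse[of Plus] by (simp add: cmp_assoc)
  also have "\<dots> = C Minus \<odot> (Tr \<odot> \<sigma> (C Plus) \<odot> B) \<odot> C Plus"
    by (simp only: 1 2 cmp_assoc)
  also have "\<dots> = \<theta> Plus \<odot> C Minus \<odot> C Plus"
    by (simp only: Tr_shift trace_C twist_C[THEN cmp_ctx, unfolded cmp_assoc])
  finally show ?thesis
    using C_inverse_left[of Plus] by simp
qed

text \<open>By \<open>arity_eta\<close> it suffices to compare after composing with
  \<open>B\<close>. Then an inner loop around \<open>C Minus\<close> gives a negative twist, the
  outer loop around \<open>C Plus\<close> a positive one, and the two cancel.\<close>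

lemma trace_\<epsilon>_\<rho>: "Tr \<cdot> (\<epsilon> \<odot> \<rho>) = I"
proof (rule arity_eta)
  show "arity 1 1 (Tr \<cdot> (\<epsilon> \<odot> \<rho>))"
    using arity_cmp[OF arity_\<epsilon> arity_\<rho>] by (intro arity_trace) (simp add: numeral_2_eq_2)
  show "arity 1 1 I"
    using bul_I_B by (intro arityI) (simp add: B_I cmp_assoc[symmetric])
  let ?C = "C Plus" and ?D = "C Minus" and ?t = "\<theta> Minus"
  have inv: "?C \<odot> ?D = I" "?D \<odot> ?C = I"
    using C_inverse_left[of Plus] C_inverse_right[of Plus] by simp_all
  have 2: "\<sigma> ?C \<odot> ?C \<odot> \<sigma> B = B \<odot> ?C"
    using braid'_natural[OF arity_B, of Plus] by (simp add: braid_1_2 B_I cmp_assoc)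
  have 1: "?C \<odot> \<sigma> B = \<sigma> ?D \<odot> B \<odot> ?C"
    using C_cancel_simps[of Plus] by (simp add: 2[symmetric] cmp_assoc)
  have 3: "?D \<odot> \<sigma> ?C \<odot> ?C = \<sigma> ?C \<odot> ?C \<odot> \<sigma> ?D"
    using braid_rule_inverse[of Plus] by simp
  have 4: "?t \<odot> \<sigma> x \<odot> y = \<sigma> x \<odot> ?t \<odot> y" for x y
    using twist_shift[THEN cmp_ctx, unfolded cmp_assoc] .
  have "(Tr \<cdot> (\<epsilon> \<odot> \<rho>)) \<odot> B = Tr \<cdot> (?D \<odot> B \<odot> Tr \<odot> ?C \<odot> \<sigma> B)"
    by (simp only: trace_natural_right[symmetric] \<epsilon>_def \<rho>_def cmp_assoc)
  also have "?D \<odot> B \<odot> Tr \<odot> ?C \<odot> \<sigma> B = ?D \<odot> B \<odot> (Tr \<odot> \<sigma> ?D \<odot> B) \<odot> ?C"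
    by (simp only: 1 cmp_assoc)
  also have "\<dots> = ?D \<odot> B \<odot> (?C \<odot> ?t)"
    by (simp only: Tr_shift trace_C C_twist)
  also have "\<dots> = (?D \<odot> \<sigma> ?C \<odot> ?C) \<odot> \<sigma> B \<odot> ?t"
    by (simp only: 2[symmetric] 2[THEN cmp_ctx, symmetric, unfolded cmp_assoc] cmp_assoc)
  also have "\<dots> = \<sigma> ?C \<odot> ?C \<odot> \<sigma> ?D \<odot> \<sigma> B \<odot> ?t"
    by (simp only: 3 cmp_assoc)
  also have "\<dots> = \<sigma> ?C \<odot> (?C \<odot> ?t) \<odot> \<sigma> (?D \<odot> B)"
    by (simp only: 4 twist_shift[symmetric] shift_cmp cmp_assoc)
  also have "\<dots> = \<sigma> ?C \<odot> \<sigma> ?t \<odot> ?C \<odot> \<sigma> (?D \<odot> B)"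
    by (simp only: C_twist shift_cmp cmp_assoc)
  also have "Tr \<cdot> \<dots> = ?C \<odot> (?t \<odot> \<theta> Plus) \<odot> ?D \<odot> B"
    by (simp only: trace_natural_left trace_natural_right trace_C cmp_assoc)
  also have "\<dots> = B"
    using twist_cancel[of Plus] inv by (simp add: cmp_assoc[symmetric])
  finally show "(Tr \<cdot> (\<epsilon> \<odot> \<rho>)) \<odot> B = I \<odot> B"
    by simp
qed

definition \<alpha> :: 'a where "\<alpha> = Tr \<cdot> (\<rho> \<odot> \<rho>)"

definition \<beta> :: 'a where "\<beta> = Tr \<cdot> (\<epsilon> \<odot> \<epsilon>)"

lemma arity_\<alpha>: "arity 0 2 \<alpha>"
  unfolding \<alpha>_def
  using arity_cmp[OF arity_\<rho> arity_Suc[OF arity_\<rho>, unfolded Suc_1]]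
  by (intro arity_trace) (simp add: numeral_2_eq_2)

lemma arity_\<beta>: "arity 2 0 \<beta>"
  unfolding \<beta>_def
  using arity_cmp[OF arity_Suc[OF arity_\<epsilon>, unfolded Suc_1] arity_\<epsilon>]
  by (intro arity_trace) (simp add: numeral_2_eq_2)

lemma shift2_trace:
  "\<sigma> (\<sigma> (Tr \<cdot> x))
    = Tr \<cdot> (C p \<odot> \<sigma> (C p) \<odot> \<sigma> (\<sigma> x) \<odot> \<sigma> (C (opp p)) \<odot> C (opp p))"
  by (simp only: trace_conj_C[symmetric, of _ p] shift_cmp cmp_assoc)

lemmas shift_ctx =
  \<rho>_shift[THEN cmp_ctx, unfolded cmp_assoc]
  \<epsilon>_shift[THEN cmp_ctx, unfolded cmp_assoc]

text \<open>The loop of \<open>\<beta>\<close> is nested inside that of \<open>\<alpha>\<close>. One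
  pair of \<open>\<rho>\<close> and \<open>\<epsilon>\<close> collapses to a positive twist,
  cancelled by the inner loop around \<open>C Minus\<close>; the remaining pair is
  \<open>trace_\<epsilon>_\<rho>\<close>.\<close>

lemma \<alpha>_\<beta>: "\<alpha> \<odot> \<sigma> \<beta> = I"
proof -
  let ?C = "C Plus" and ?D = "C Minus" and ?t = "\<theta> Plus"
  have "\<alpha> \<odot> \<sigma> \<beta> = Tr \<cdot> (\<rho> \<odot> \<rho> \<odot> \<sigma> (\<sigma> \<beta>))"
    by (simp only: \<alpha>_def trace_natural_right[symmetric] cmp_assoc)
  \<comment> \<open>The sign is chosen so that \<open>C Plus\<close> ends up between
    \<open>\<rho>\<close> and \<open>\<epsilon>\<close>, as \<open>\<rho>_\<epsilon>\<close>
    requires.\<close>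
  also have "\<sigma> (\<sigma> \<beta>) = Tr \<cdot> (?C \<odot> \<sigma> ?C \<odot> \<sigma> (\<sigma> (\<epsilon> \<odot> \<epsilon>)) \<odot> \<sigma> ?D \<odot> ?D)"
    by (simp only: \<beta>_def shift2_trace[of _ Plus] opp.simps)
  also have "\<rho> \<odot> \<rho> \<odot> \<dots>
      = Tr \<cdot> (\<sigma> \<rho> \<odot> (\<sigma> \<rho> \<odot> ?C \<odot> \<sigma> ?C) \<odot> \<sigma> (\<sigma> \<epsilon>) \<odot> \<sigma> (\<sigma> \<epsilon>) \<odot> \<sigma> ?D \<odot> ?D)"
    by (simp only: trace_natural_left[symmetric] shift_cmp cmp_assoc)
  also have "\<sigma> \<rho> \<odot> (\<sigma> \<rho> \<odot> ?C \<odot> \<sigma> ?C) \<odot> \<sigma> (\<sigma> \<epsilon>) \<odot> \<sigma> (\<sigma> \<epsilon>) \<odot> \<sigma> ?D \<odot> ?D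
      = \<sigma> \<rho> \<odot> ?C \<odot> (\<rho> \<odot> \<sigma> (\<sigma> \<epsilon>)) \<odot> \<sigma> (\<sigma> \<epsilon>) \<odot> \<sigma> ?D \<odot> ?D"
    by (simp only: C_\<rho>[symmetric] cmp_assoc)
  also have "\<dots> = (\<sigma> \<rho> \<odot> ?C \<odot> \<sigma> \<epsilon>) \<odot> \<sigma> \<epsilon> \<odot> (\<rho> \<odot> \<sigma> ?D \<odot> ?D)"
    by (simp only: shift_ctx cmp_assoc)
  also have "\<dots> = (?t \<odot> \<sigma> \<epsilon>) \<odot> ?D \<odot> \<sigma> \<rho>"
    by (simp only: \<rho>_\<epsilon> \<rho>_C cmp_assoc)
  also have "\<dots> = \<sigma> \<epsilon> \<odot> (?t \<odot> ?D) \<odot> \<sigma> \<rho>"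
    by (simp only: twist_shift cmp_assoc)
  also have "\<dots> = \<sigma> \<epsilon> \<odot> ?D \<odot> \<sigma> (?t \<odot> \<rho>)"
    by (simp only: twist_C shift_cmp cmp_assoc)
  also have "Tr \<cdot> \<dots> = \<epsilon> \<odot> (\<theta> Minus \<odot> ?t) \<odot> \<rho>"
    by (simp only: trace_natural_left trace_natural_right trace_C cmp_assoc)
  also have "\<dots> = \<epsilon> \<odot> \<rho>"
    using twist_cancel[of Minus] by simp
  finally show ?thesis
    by (simp only: trace_\<epsilon>_\<rho>)
qed

lemma \<beta>_\<alpha>: "\<sigma> \<alpha> \<odot> \<beta> = I"
proof -
  let ?C = "C Plus" and ?D = "C Minus" and ?t = "\<theta> Plus"
  have "\<sigma> \<alpha> \<odot> \<beta> = Tr \<cdot> (\<sigma> (\<sigma> \<alpha>) \<odot> \<epsilon> \<odot> \<epsilon>)"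
    by (simp only: \<beta>_def trace_natural_left)
  \<comment> \<open>Here the crossings at the end of the loop are the ones that meet
    \<open>\<epsilon>\<close>, so the opposite sign is needed to obtain
    \<open>C Plus\<close>.\<close>
  also have "\<sigma> (\<sigma> \<alpha>) = Tr \<cdot> (?D \<odot> \<sigma> ?D \<odot> \<sigma> (\<sigma> (\<rho> \<odot> \<rho>)) \<odot> \<sigma> ?C \<odot> ?C)"
    by (simp only: \<alpha>_def shift2_trace[of _ Minus] opp.simps)
  also have "\<dots> \<odot> \<epsilon> \<odot> \<epsilon>
      = Tr \<cdot> (?D \<odot> \<sigma> ?D \<odot> \<sigma> (\<sigma> \<rho>) \<odot> \<sigma> (\<sigma> \<rho>) \<odot> (\<sigma> ?C \<odot> ?C \<odot> \<sigma> \<epsilon>) \<odot> \<sigma> \<epsilon>)"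
    by (simp only: trace_natural_right[symmetric] shift_cmp cmp_assoc)
  also have "?D \<odot> \<sigma> ?D \<odot> \<sigma> (\<sigma> \<rho>) \<odot> \<sigma> (\<sigma> \<rho>) \<odot> (\<sigma> ?C \<odot> ?C \<odot> \<sigma> \<epsilon>) \<odot> \<sigma> \<epsilon>
      = ?D \<odot> \<sigma> ?D \<odot> \<sigma> (\<sigma> \<rho>) \<odot> \<sigma> (\<sigma> \<rho>) \<odot> \<epsilon> \<odot> ?C \<odot> \<sigma> \<epsilon>"
    by (simp only: \<epsilon>_C[symmetric] cmp_assoc)
  also have "\<dots> = ?D \<odot> \<sigma> ?D \<odot> \<epsilon> \<odot> \<sigma> \<rho> \<odot> (\<sigma> \<rho> \<odot> ?C \<odot> \<sigma> \<epsilon>)"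
    by (simp only: shift_ctx cmp_assoc)
  also have "\<dots> = (?D \<odot> \<sigma> ?D \<odot> \<epsilon>) \<odot> \<sigma> \<rho> \<odot> ?t"
    by (simp only: \<rho>_\<epsilon> cmp_assoc)
  also have "\<dots> = \<sigma> \<epsilon> \<odot> (?D \<odot> ?t) \<odot> \<sigma> \<rho>"
    by (simp only: C_\<epsilon> twist_shift cmp_assoc)
  also have "\<dots> = \<sigma> \<epsilon> \<odot> \<sigma> ?t \<odot> ?D \<odot> \<sigma> \<rho>"
    by (simp only: C_twist cmp_assoc)
  also have "Tr \<cdot> \<dots> = \<epsilon> \<odot> (?t \<odot> \<theta> Minus) \<odot> \<rho>"
    by (simp only: trace_natural_left trace_natural_right trace_C cmp_assoc)
  also have "\<dots> = \<epsilon> \<odot> \<rho>"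
    using twist_cancel[of Plus] by simp
  finally show ?thesis
    by (simp only: trace_\<epsilon>_\<rho>)
qed

text \<open>The axiom \<open>twist_B\<close> carried through the crossing in
  \<open>\<epsilon>\<close> and solved for the double crossing.\<close>

lemma full_twist_\<epsilon>: "C p \<odot> C p \<odot> \<theta> p \<odot> \<epsilon> = \<sigma> (\<theta> (opp p)) \<odot> \<epsilon> \<odot> \<theta> p"
proof -
  let ?C = "C p" and ?D = "C Minus" and ?t = "\<theta> p" and ?s = "\<theta> (opp p)"
  have "\<sigma> ?s \<odot> \<epsilon> \<odot> ?t = \<sigma> ?s \<odot> (?D \<odot> ?t) \<odot> ?C \<odot> ?t \<odot> ?C \<odot> B"
    by (simp only: \<epsilon>_def twist_B cmp_assoc)
  also have "\<dots> = \<sigma> (?s \<odot> ?t) \<odot> ?D \<odot> ?C \<odot> (?t \<odot> ?C) \<odot> B"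
    by (simp only: C_twist shift_cmp cmp_assoc)
  also have "\<dots> = (?D \<odot> ?C) \<odot> ?C \<odot> \<sigma> ?t \<odot> B"
    by (simp add: twist_cancel twist_C cmp_assoc B_I)
  also have "\<dots> = ?C \<odot> ?C \<odot> (?D \<odot> \<sigma> ?t) \<odot> B"
    by (simp only: C_commute[of Minus p, THEN cmp_ctx, unfolded cmp_assoc] cmp_assoc)
  finally show ?thesis
    by (simp only: twist_C[symmetric] \<epsilon>_def cmp_assoc)
qed

lemma \<beta>_slide: "\<beta> = C (opp p) \<odot> \<sigma> (\<theta> (opp p)) \<odot> \<beta>"
proof -
  let ?C = "C p" and ?D = "C (opp p)" and ?t = "\<theta> p" and ?s = "\<theta> (opp p)"
  let ?x = "\<sigma> ?C \<odot> \<epsilon> \<odot> ?s \<odot> \<sigma> \<epsilon>"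
  \<comment> \<open>\<open>?x\<close> is two copies of \<open>\<epsilon>\<close> side by side. Closing both loops after a crossing chains the
    copies together, in an order that depends on which side the crossing is placed.\<close>
  have "?C \<odot> ?x = (?C \<odot> \<sigma> ?C \<odot> \<epsilon>) \<odot> ?s \<odot> \<sigma> \<epsilon>"
    by (simp only: cmp_assoc)
  also have "\<dots> = \<sigma> \<epsilon> \<odot> (?C \<odot> ?s) \<odot> \<sigma> \<epsilon>"
    by (simp only: C_\<epsilon> cmp_assoc)
  also have "\<dots> = \<sigma> \<epsilon> \<odot> \<sigma> ?s \<odot> ?C \<odot> \<sigma> \<epsilon>"
    by (simp only: C_twist cmp_assoc)
  \<comment> \<open>Closing a loop around \<open>?C\<close> contributes the twist \<open>?t\<close>;
    the factor \<open>?s\<close> was put into \<open>?x\<close> to cancel it.\<close>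
  finally have "Tr \<cdot> (?C \<odot> ?x) = \<epsilon> \<odot> (?s \<odot> ?t) \<odot> \<epsilon>"
    by (simp only: trace_natural_left trace_natural_right trace_C cmp_assoc)
  then have left: "Tr \<cdot> (Tr \<cdot> (?C \<odot> ?x)) = \<beta>"
    by (simp only: twist_cancel_simps \<beta>_def cmp_I_left cmp_assoc)
  have "?x \<odot> ?C = \<sigma> ?C \<odot> \<epsilon> \<odot> \<sigma> \<epsilon> \<odot> (?s \<odot> ?C)"
    by (simp only: twist_shift twist_shift[THEN cmp_ctx, unfolded cmp_assoc] cmp_assoc)
  also have "\<dots> = \<sigma> ?C \<odot> \<epsilon> \<odot> (\<sigma> \<epsilon> \<odot> ?C) \<odot> \<sigma> ?s"
    by (simp only: twist_C cmp_assoc)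
  also have "\<dots> = \<sigma> ?C \<odot> (\<epsilon> \<odot> ?C) \<odot> \<sigma> ?C \<odot> \<epsilon> \<odot> \<sigma> ?s"
    by (simp only: C_\<epsilon>[symmetric] cmp_assoc)
  also have "\<dots> = \<sigma> ?C \<odot> \<sigma> ?C \<odot> (?C \<odot> \<sigma> (\<sigma> ?C)) \<odot> \<sigma> ?C \<odot> (\<sigma> (\<sigma> \<epsilon>) \<odot> \<epsilon>) \<odot> \<sigma> ?s"
    by (simp only: \<epsilon>_C \<epsilon>_C[THEN shift_cong, THEN cmp_ctx, unfolded shift_cmp cmp_assoc]
        cmp_assoc)
  also have "\<dots> = \<sigma> ?C \<odot> \<sigma> ?C \<odot> \<sigma> (\<sigma> ?C) \<odot> (?C \<odot> \<sigma> ?C \<odot> \<epsilon>) \<odot> \<sigma> \<epsilon> \<odot> \<sigma> ?s"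
    by (simp only: \<epsilon>_shift[symmetric] C_shift[symmetric] cmp_assoc)
  also have "\<dots> = \<sigma> ?C \<odot> \<sigma> ?C \<odot> \<sigma> (\<sigma> ?C) \<odot> \<sigma> \<epsilon> \<odot> ?C \<odot> \<sigma> (\<epsilon> \<odot> ?s)"
    by (simp only: C_\<epsilon> shift_cmp cmp_assoc)
  finally have "Tr \<cdot> (?x \<odot> ?C) = ?C \<odot> ?C \<odot> \<sigma> ?C \<odot> \<epsilon> \<odot> ?t \<odot> \<epsilon> \<odot> ?s"
    by (simp only: trace_natural_left trace_natural_right trace_C cmp_assoc)
  \<comment> \<open>The inserted pair lets \<open>\<epsilon>\<close> be pulled through the
    crossings, leaving the double crossing before the second \<open>\<epsilon>\<close>, where
    \<open>full_twist_\<epsilon>\<close> removes it.\<close>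
  also have "\<dots> = \<sigma> ?D \<odot> \<sigma> ?C \<odot> ?C \<odot> (?C \<odot> \<sigma> ?C \<odot> \<epsilon>) \<odot> ?t \<odot> \<epsilon> \<odot> ?s"
    by (simp only: C_cancel_simps cmp_assoc)
  also have "\<dots> = \<sigma> ?D \<odot> (\<sigma> ?C \<odot> ?C \<odot> \<sigma> \<epsilon>) \<odot> ?C \<odot> ?t \<odot> \<epsilon> \<odot> ?s"
    by (simp only: C_\<epsilon> cmp_assoc)
  also have "\<dots> = \<sigma> ?D \<odot> \<epsilon> \<odot> (?C \<odot> ?C \<odot> ?t \<odot> \<epsilon>) \<odot> ?s"
    by (simp only: \<epsilon>_C[symmetric] cmp_assoc)
  also have "\<dots> = \<sigma> ?D \<odot> (\<epsilon> \<odot> \<sigma> ?s) \<odot> \<epsilon> \<odot> (?t \<odot> ?s)"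
    by (simp only: full_twist_\<epsilon> cmp_assoc)
  also have "\<dots> = \<sigma> (?D \<odot> \<sigma> ?s) \<odot> \<epsilon> \<odot> \<epsilon>"
    by (simp add: \<epsilon>_shift twist_cancel shift_cmp cmp_assoc)
  finally have "Tr \<cdot> (Tr \<cdot> (?x \<odot> ?C)) = Tr \<cdot> (\<sigma> (?D \<odot> \<sigma> ?s) \<odot> \<epsilon> \<odot> \<epsilon>)"
    by (rule arg_cong)
  then have right: "Tr \<cdot> (Tr \<cdot> (?x \<odot> ?C)) = ?D \<odot> \<sigma> ?s \<odot> \<beta>"
    by (simp only: trace_natural_left \<beta>_def cmp_assoc)
  show ?thesis
    by (rule trans[OF trans[OF left[symmetric] trace_slide_C] right])
qed

text \<open>By \<open>\<beta>_slide\<close> for both signs, \<open>\<beta>\<close> absorbs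
  \<open>C p\<close> together with a twist on either of its strands.\<close>

lemma \<beta>_twist: "\<theta> p \<odot> \<beta> = \<sigma> (\<theta> p) \<odot> \<beta>"
proof -
  let ?C = "C p" and ?D = "C (opp p)" and ?t = "\<theta> p" and ?s = "\<theta> (opp p)"
  have "?C \<odot> ?t \<odot> \<beta> = \<sigma> ?t \<odot> ?C \<odot> ?D \<odot> \<sigma> ?s \<odot> \<beta>"
    by (subst \<beta>_slide[of p]) (simp only: C_twist[THEN cmp_ctx, unfolded cmp_assoc])
  also have "\<dots> = \<beta>"
    by (simp only: C_cancel_simps twist_cancel_simps)
  also have "\<dots> = ?C \<odot> \<sigma> ?t \<odot> \<beta>"
    by (rule \<beta>_slide[of "opp p", unfolded opp_opp])
  finally show ?thesis
    by (rule C_cancel)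
qed

lemma ribbon: "ribbon_extensional_BCI_algebra app B C I \<theta> \<alpha> \<beta>"
proof unfold_locales
  show "bul \<alpha> \<odot> B = \<sigma> \<alpha> \<odot> B \<up> 2"
    using arityD[OF arity_\<alpha>] by simp
  show "bul \<beta> \<odot> B \<up> 3 = \<sigma> \<beta>"
    using arityD[OF arity_\<beta>] by (simp add: numeral_2_eq_2 numeral_3_eq_3)
  show "\<alpha> \<odot> \<sigma> \<beta> = B \<cdot> I" "\<sigma> \<alpha> \<odot> \<beta> = B \<cdot> I"
    by (simp_all add: \<alpha>_\<beta> \<beta>_\<alpha> B_I)
  show "\<alpha> \<odot> \<theta> p = \<alpha> \<odot> \<sigma> (\<theta> p)" for p
    using arity_twist_transfer[OF arity_\<alpha> arity_\<beta> \<alpha>_\<beta> \<beta>_\<alpha> arity_twist] \<beta>_twist by simp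
qed

end


section \<open>A ribbon duality and the twist on two strands\<close>

context ribbon_extensional_BCI_algebra
begin

lemma arity_\<alpha>: "arity 0 2 \<alpha>"
  using alpha_B by (intro arityI) (simp add: cmp_assoc)

lemma arity_\<beta>: "arity 2 0 \<beta>"
  using beta_B by (intro arityI) (simp add: numeral_2_eq_2 numeral_3_eq_3 cmp_assoc)

lemma \<alpha>_shift: "\<alpha> \<odot> \<sigma> (\<sigma> x) = x \<odot> \<alpha>"
  using arity_interchange[OF arity_\<alpha>, of x] by (simp add: numeral_2_eq_2 I_app)

lemma \<beta>_twist: "\<theta> p \<odot> \<beta> = \<sigma> (\<theta> p) \<odot> \<beta>"
  using arity_twist_transfer[OF arity_\<alpha> arity_\<beta> _ _ arity_twist, of p]
    alpha_beta beta_alpha alpha_twist[of p] by (simp add: B_I)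

lemma C_C_\<alpha>: "\<alpha> \<odot> \<sigma> (C p) \<odot> C p = \<sigma> \<alpha>"
  using braid'_natural[OF arity_\<alpha>, of p] by (simp add: braid_1_2)

lemma C_\<beta>: "C p \<odot> \<sigma> (C p) \<odot> \<beta> = \<sigma> \<beta>"
  using braid_natural[OF arity_\<beta>, of p] by (simp add: braid_1_2 cmp_assoc)

lemma \<beta>_C: "\<sigma> (C p) \<odot> C p \<odot> \<sigma> \<beta> = \<beta>"
  using braid'_natural[OF arity_\<beta>, of p] by (simp add: braid_1_2 cmp_assoc)

lemma arity_bul_B_B: "arity 2 1 (bul a \<odot> B \<odot> B)"
proof -
  have "arity 2 3 (bul a)" "arity 3 2 B"
    using arity_add[OF arity_bul, of 2] arity_add[OF arity_B, of 1]
    by (simp_all add: numeral_2_eq_2 numeral_3_eq_3)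
  then show ?thesis
    by (intro arity_cmp[of 2 3] arity_cmp[of 3 2] arity_B)
qed

text \<open>Naturality of the twist at \<open>\<beta>\<close>. The axioms provide it for points and
  for \<open>B\<close>, so \<open>\<beta>\<close> has to be assembled from these.\<close>

lemma twist_2_\<beta>: "\<theta> p \<odot> C p \<odot> \<theta> p \<odot> C p \<odot> \<beta> = \<beta>"
proof -
  let ?t = "\<theta> p" and ?C = "C p"
  \<comment> \<open>\<open>H\<close> merges the point of \<open>\<beta>\<close> with two further
    strands; composing it with \<open>B\<close> recovers \<open>\<beta>\<close> behind one
    strand.\<close>
  define H where "H = bul \<beta> \<odot> B \<odot> B"
  have H_B: "H \<odot> B = \<sigma> \<beta>"
    using beta_B by (simp add: H_def numeral_3_eq_3 cmp_assoc)
  have "arity 2 1 (bul \<beta> \<odot> B \<odot> B)"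
    by (rule arity_bul_B_B)
  then have arity_H: "arity 2 1 H"
    by (simp only: H_def)
  have H_C: "H \<odot> ?C = \<sigma> ?C \<odot> ?C \<odot> \<sigma> H"
    using braid'_natural[OF arity_H, of p] by (simp add: braid_1_2 B_I cmp_assoc)
  have C_H: "\<sigma> H \<odot> ?C = ?C \<odot> \<sigma> ?C \<odot> H"
    using braid_natural[OF arity_H, of p] by (simp add: braid_1_2 B_I cmp_assoc)
  have B_C: "B \<odot> ?C = \<sigma> ?C \<odot> ?C \<odot> \<sigma> B"
    using braid'_natural[OF arity_B, of p] by (simp add: braid_1_2 B_I cmp_assoc)
  have shift_t: "\<sigma> x \<odot> ?t \<odot> y = ?t \<odot> \<sigma> x \<odot> y" for x y
    using twist_shift[of p x] by (simp add: cmp_assoc[symmetric])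
  have "H \<odot> ?t = (bul \<beta> \<odot> ?t) \<odot> ?C \<odot> ?t \<odot> ?C \<odot> B \<odot> ?C \<odot> ?t \<odot> ?C \<odot> B"
    by (simp only: H_def twist_B twist_B[THEN cmp_ctx, unfolded cmp_assoc] cmp_assoc)
  also have "\<dots> = \<sigma> (bul \<beta>) \<odot> ?t \<odot> ?C \<odot> B \<odot> ?C \<odot> ?t \<odot> ?C \<odot> B"
    by (simp only: bul_twist bul_C[THEN cmp_ctx, unfolded cmp_assoc] cmp_assoc)
  also have "\<dots> = ?t \<odot> bul \<beta> \<odot> (B \<odot> ?C) \<odot> ?t \<odot> ?C \<odot> B"
    by (simp only: shift_t shift_bul_C[THEN cmp_ctx, unfolded cmp_assoc] cmp_assoc)
  also have "\<dots> = ?t \<odot> (bul \<beta> \<odot> \<sigma> ?C) \<odot> ?C \<odot> \<sigma> B \<odot> ?t \<odot> ?C \<odot> B"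
    by (simp only: B_C[THEN cmp_ctx, unfolded cmp_assoc] cmp_assoc)
  also have "\<dots> = ?t \<odot> ?C \<odot> (bul \<beta> \<odot> ?C) \<odot> \<sigma> B \<odot> ?t \<odot> ?C \<odot> B"
    by (simp only: bul_shift[THEN cmp_ctx, unfolded cmp_assoc] cmp_assoc)
  also have "\<dots> = ?t \<odot> ?C \<odot> ?t \<odot> \<sigma> (bul \<beta>) \<odot> (\<sigma> B \<odot> ?C) \<odot> B"
    by (simp only: bul_C[THEN cmp_ctx, unfolded cmp_assoc] shift_t cmp_assoc)
  also have "\<dots> = ?t \<odot> ?C \<odot> ?t \<odot> (\<sigma> (bul \<beta>) \<odot> ?C) \<odot> \<sigma> ?C \<odot> B \<odot> B"
    by (simp only: B_B_C[THEN cmp_ctx, unfolded cmp_assoc] cmp_assoc)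
  also have "\<dots> = ?t \<odot> ?C \<odot> ?t \<odot> (bul \<beta> \<odot> \<sigma> ?C) \<odot> B \<odot> B"
    by (simp only: shift_bul_C[THEN cmp_ctx, unfolded cmp_assoc] cmp_assoc)
  finally have H_twist: "H \<odot> ?t = ?t \<odot> ?C \<odot> ?t \<odot> ?C \<odot> H"
    by (simp only: bul_shift[THEN cmp_ctx, unfolded cmp_assoc] H_def cmp_assoc)
  define w where "w = ?t \<odot> ?C \<odot> ?t \<odot> ?C"
  have "arity 2 2 ?t"
    using arity_Suc[OF arity_twist, of p] by (simp add: numeral_2_eq_2)
  then have arity_w: "arity 2 2 w"
    unfolding w_def by (intro arity_cmp[of 2 2] arity_C)
  have C_w: "?C \<odot> \<sigma> ?C \<odot> w = \<sigma> w \<odot> ?C \<odot> \<sigma> ?C"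
    using braid_natural[OF arity_w, of p] by (simp add: braid_1_2 cmp_assoc)
  \<comment> \<open>The twist passes \<open>\<sigma> \<beta>\<close> directly by
    \<open>twist_shift\<close>, and passes its factorization \<open>H \<odot> B\<close> by
    \<open>twist_B\<close> and \<open>H_twist\<close>. Comparing the two results isolates
    \<open>w \<odot> \<beta>\<close> behind one strand.\<close>
  have "?t \<odot> \<sigma> \<beta> = (H \<odot> B) \<odot> ?t"
    by (simp only: twist_shift H_B)
  also have "\<dots> = (H \<odot> ?t) \<odot> ?C \<odot> ?t \<odot> ?C \<odot> B"
    by (simp only: twist_B cmp_assoc)
  also have "\<dots> = ?t \<odot> ?C \<odot> ?t \<odot> ?C \<odot> (H \<odot> ?C) \<odot> ?t \<odot> ?C \<odot> B"
    by (simp only: H_twist[THEN cmp_ctx, unfolded cmp_assoc] cmp_assoc)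
  also have "\<dots> = ?t \<odot> ?C \<odot> ?t \<odot> ?C \<odot> \<sigma> ?C \<odot> ?C \<odot> ?t \<odot> (\<sigma> H \<odot> ?C) \<odot> B"
    by (simp only: H_C[THEN cmp_ctx, unfolded cmp_assoc] shift_t cmp_assoc)
  also have "\<dots> = ?t \<odot> ?C \<odot> ?t \<odot> ?C \<odot> \<sigma> ?C \<odot> ?C \<odot> ?t \<odot> ?C \<odot> \<sigma> ?C \<odot> \<sigma> \<beta>"
    by (simp only: C_H[THEN cmp_ctx, unfolded cmp_assoc] H_B cmp_assoc)
  also have "\<dots> = ?t \<odot> ?C \<odot> ?t \<odot> (?C \<odot> \<sigma> ?C \<odot> ?C) \<odot> ?t \<odot> ?C \<odot> \<sigma> ?C \<odot> \<sigma> \<beta>"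
    by (simp only: cmp_assoc)
  also have "\<dots> = ?t \<odot> ?C \<odot> \<sigma> ?C \<odot> ?t \<odot> ?C \<odot> ?t \<odot> (\<sigma> ?C \<odot> ?C \<odot> \<sigma> ?C) \<odot> \<sigma> \<beta>"
    by (simp only: braid_rule[THEN cmp_ctx, symmetric, unfolded cmp_assoc] shift_t cmp_assoc)
  also have "\<dots> = ?t \<odot> ?C \<odot> \<sigma> ?C \<odot> w \<odot> (\<sigma> ?C \<odot> ?C \<odot> \<sigma> \<beta>)"
    by (simp only: braid_rule[THEN cmp_ctx, unfolded cmp_assoc] w_def cmp_assoc)
  also have "\<dots> = ?t \<odot> (?C \<odot> \<sigma> ?C \<odot> w) \<odot> \<beta>"
    by (simp only: \<beta>_C cmp_assoc)
  also have "\<dots> = ?t \<odot> \<sigma> w \<odot> (?C \<odot> \<sigma> ?C \<odot> \<beta>)"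
    by (simp only: C_w[THEN cmp_ctx, unfolded cmp_assoc] cmp_assoc)
  also have "\<dots> = ?t \<odot> \<sigma> (w \<odot> \<beta>)"
    by (simp only: C_\<beta> shift_cmp)
  finally have "\<theta> (opp p) \<odot> ?t \<odot> \<sigma> \<beta> = \<theta> (opp p) \<odot> ?t \<odot> \<sigma> (w \<odot> \<beta>)"
    by simp
  then have "\<sigma> (w \<odot> \<beta>) = \<sigma> \<beta>"
    by (simp only: twist_cancel_simps)
  then have "w \<odot> \<beta> = \<beta>"
    by (rule shift_inject)
  then show ?thesis
    by (simp only: w_def cmp_assoc)
qed

text \<open>Inserting \<open>twist_2_\<beta>\<close> for \<open>Plus\<close> into the negative
  expression cancels the negative twist and crossing. Hence one cap \<open>\<gamma>\<close> serves
  both signs in \<open>tr_C\<close>.\<close>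

lemma C_twist_\<beta>: "C p \<odot> \<theta> p \<odot> \<beta> = C q \<odot> \<theta> q \<odot> \<beta>"
proof -
  have "C Minus \<odot> \<theta> Minus \<odot> \<beta> = C Minus \<odot> \<theta> Minus \<odot> \<theta> Plus \<odot> C Plus \<odot> \<theta> Plus \<odot> C Plus \<odot> \<beta>"
    by (simp only: twist_2_\<beta>[of Plus])
  also have "\<dots> = \<theta> Plus \<odot> C Plus \<odot> \<beta>"
    using twist_cancel_simps[of Minus] C_cancel_simps[of Minus] by simp
  also have "\<dots> = C Plus \<odot> \<theta> Plus \<odot> \<beta>"
    by (simp only: twist_C[THEN cmp_ctx, unfolded cmp_assoc] \<beta>_twist)
  finally show ?thesis
    by (cases p; cases q) simp_all
qed

section \<open>The trace defined by a ribbon duality\<close>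

definition \<gamma> :: 'a where "\<gamma> = C Plus \<odot> \<theta> Plus \<odot> \<beta>"

lemma arity_\<gamma>: "arity 2 0 \<gamma>"
  unfolding \<gamma>_def
  using arity_add[OF arity_twist, of 1 Plus]
  by (intro arity_cmp[of 2 2] arity_C arity_\<beta>) (simp add: numeral_2_eq_2)

text \<open>The cap \<open>\<gamma>\<close> closes the pair of strands opened by
  \<open>\<alpha>\<close>. Evaluated at \<open>x\<close>, \<open>G\<close> gives
  \<open>\<sigma> x \<odot> \<gamma>\<close>, so closing a strand becomes an element of the
  algebra.\<close>

definition G :: 'a where "G = bul \<gamma> \<odot> B \<odot> B"

definition tr :: 'a where "tr = \<sigma> \<alpha> \<odot> G"

lemma G_B: "G \<odot> B = \<sigma> \<gamma>"
  using arityD[OF arity_\<gamma>] by (simp add: G_def numeral_2_eq_2 cmp_assoc)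

lemma tr_app: "tr \<cdot> x = \<alpha> \<odot> \<sigma> x \<odot> \<gamma>"
  by (simp add: tr_def G_def bul_app) (simp add: cmp_def)

lemma arity_G: "arity 2 1 G"
  unfolding G_def by (rule arity_bul_B_B)

lemma G_shift: "G \<odot> \<sigma> x = \<sigma> (\<sigma> x) \<odot> G"
  using arity_interchange[OF arity_G, of x] by (simp add: numeral_2_eq_2 I_app)

lemma \<gamma>_shift: "\<sigma> (\<sigma> x) \<odot> \<gamma> = \<gamma> \<odot> x"
  using arity_interchange[OF arity_\<gamma>, of x] by (simp add: numeral_2_eq_2 I_app)

lemma arity_tr: "arity 1 2 tr"
  unfolding tr_def
  using arity_shift[OF arity_\<alpha>] arity_add[OF arity_G, of 1]
  by (intro arity_cmp[of 1 3]) (simp_all add: numeral_3_eq_3 numeral_2_eq_2)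

text \<open>The cup \<open>\<alpha>\<close> passes \<open>B\<close> by \<open>B_shift\<close>, so
  only \<open>G\<close> matters. There \<open>arity_eta\<close> allows a further \<open>B\<close> to
  be appended, and \<open>G_B\<close> turns both sides into the shifted cap.\<close>

lemma tr_B: "\<sigma> tr \<odot> bul B \<odot> B \<odot> B = B \<odot> tr"
proof -
  have "\<sigma> G \<odot> bul B \<odot> B \<odot> B = B \<odot> G"
  proof (rule arity_eta)
    show "arity 3 1 (B \<odot> G)"
      using arity_add[OF arity_B, of 1] arity_G
      by (intro arity_cmp[of 3 2]) (simp_all add: numeral_3_eq_3 numeral_2_eq_2)
    show "arity 3 1 (\<sigma> G \<odot> bul B \<odot> B \<odot> B)"
      using arity_shift[OF arity_G] arity_bul_B_B
      by (intro arity_cmp[of 3 2]) (simp_all add: numeral_3_eq_3 numeral_2_eq_2)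
    have "(\<sigma> G \<odot> bul B \<odot> B \<odot> B) \<odot> B = \<sigma> (G \<odot> B) \<odot> B"
      using bul_B by (simp add: cmp_assoc shift_cmp)
    then show "(\<sigma> G \<odot> bul B \<odot> B \<odot> B) \<odot> B = (B \<odot> G) \<odot> B"
      by (simp add: G_B cmp_assoc B_shift)
  qed
  then show ?thesis
    by (simp add: tr_def shift_cmp cmp_assoc B_shift[THEN cmp_ctx, unfolded cmp_assoc])
qed

lemma tr_C: "tr \<cdot> C p = \<theta> p"
proof -
  \<comment> \<open>The crossing inside \<open>\<gamma>\<close> is given the sign \<open>p\<close>,
    so that it matches \<open>C p\<close> in \<open>C_C_\<alpha>\<close>.\<close>
  have "tr \<cdot> C p = (\<alpha> \<odot> \<sigma> (C p) \<odot> C p) \<odot> \<theta> p \<odot> \<beta>"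
    by (simp only: tr_app \<gamma>_def C_twist_\<beta>[of Plus p] cmp_assoc)
  also have "\<dots> = \<theta> p \<odot> \<sigma> \<alpha> \<odot> \<beta>"
    by (simp only: C_C_\<alpha> twist_shift[THEN cmp_ctx, unfolded cmp_assoc])
  finally show ?thesis
    using beta_alpha by (simp add: B_I)
qed

text \<open>A crossing is rotated around two nested cups. Pulling the inner cup across a leg of the
  outer one with opposite crossings cancels \<open>C p\<close> on one side, and naturality of
  \<open>\<alpha>\<close> recreates it on the other.\<close>

lemma \<alpha>_\<alpha>_C: "\<alpha> \<odot> \<sigma> \<alpha> \<odot> \<sigma> (\<sigma> (C p)) = \<alpha> \<odot> \<sigma> \<alpha> \<odot> C p"
proof -
  let ?C = "C p" and ?D = "C (opp p)"
  have "\<sigma> (\<sigma> \<alpha> \<odot> ?D \<odot> \<sigma> ?D) = \<sigma> \<alpha>"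
    using braid_natural[OF arity_\<alpha>, of "opp p", symmetric] by (simp add: braid_1_2)
  then have "\<alpha> \<odot> \<sigma> \<alpha> \<odot> \<sigma> (\<sigma> ?C) = \<alpha> \<odot> \<sigma> (\<sigma> \<alpha> \<odot> ?D \<odot> \<sigma> ?D) \<odot> \<sigma> (\<sigma> ?C)"
    by simp
  also have "\<dots> = \<alpha> \<odot> \<sigma> (\<sigma> \<alpha> \<odot> ?D \<odot> \<sigma> (?D \<odot> ?C))"
    by (simp only: shift_cmp cmp_assoc)
  also have "\<dots> = (\<alpha> \<odot> \<sigma> (\<sigma> \<alpha>)) \<odot> \<sigma> ?D"
    by (simp add: C_inverse_left B_I shift_cmp cmp_assoc)
  also have "\<dots> = \<alpha> \<odot> (\<alpha> \<odot> \<sigma> ?D \<odot> ?D) \<odot> ?C"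
    by (simp add: \<alpha>_shift C_inverse_left cmp_assoc)
  finally show ?thesis
    by (simp only: C_C_\<alpha> cmp_assoc)
qed

lemma C_\<gamma>_\<gamma>: "\<sigma> (\<sigma> (C p)) \<odot> \<sigma> \<gamma> \<odot> \<gamma> = C p \<odot> \<sigma> \<gamma> \<odot> \<gamma>"
proof -
  let ?C = "C p" and ?D = "C (opp p)"
  have "\<sigma> (\<sigma> ?D \<odot> ?D \<odot> \<sigma> \<gamma>) = \<sigma> \<gamma>"
    using braid'_natural[OF arity_\<gamma>, of "opp p", symmetric] by (simp add: braid_1_2 cmp_assoc)
  then have "\<sigma> (\<sigma> ?C) \<odot> \<sigma> \<gamma> \<odot> \<gamma> = \<sigma> (\<sigma> ?C) \<odot> \<sigma> (\<sigma> ?D \<odot> ?D \<odot> \<sigma> \<gamma>) \<odot> \<gamma>"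
    by simp
  also have "\<dots> = \<sigma> (\<sigma> (?C \<odot> ?D) \<odot> ?D \<odot> \<sigma> \<gamma>) \<odot> \<gamma>"
    by (simp only: shift_cmp cmp_assoc)
  also have "\<dots> = \<sigma> ?D \<odot> \<sigma> (\<sigma> \<gamma>) \<odot> \<gamma>"
    by (simp add: C_inverse_right B_I shift_cmp cmp_assoc)
  also have "\<dots> = ?C \<odot> (?D \<odot> \<sigma> ?D \<odot> \<gamma>) \<odot> \<gamma>"
    by (simp only: \<gamma>_shift C_cancel_simps cmp_assoc)
  also have "?D \<odot> \<sigma> ?D \<odot> \<gamma> = \<sigma> \<gamma>"
    using braid_natural[OF arity_\<gamma>, of "opp p"] by (simp add: braid_1_2 cmp_assoc)
  finally show ?thesis .
qed

text \<open>Composing with \<open>B\<close> twice turns \<open>G \<odot> G\<close> into two nested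
  caps behind one strand. There \<open>C_\<gamma>_\<gamma>\<close> rotates the negative crossing
  onto the positive one.\<close>

lemma G_G_C: "\<sigma> (C Plus) \<odot> G \<odot> G \<odot> bul (C Minus) \<odot> B = G \<odot> G"
proof -
  let ?C = "C Plus" and ?D = "C Minus"
  let ?u = "\<sigma> ?C \<odot> G \<odot> G \<odot> bul ?D \<odot> B"
  have GG: "G \<odot> G \<odot> B \<odot> B = \<sigma> (\<sigma> \<gamma> \<odot> \<gamma>)"
    by (simp only: G_B G_B[THEN cmp_ctx, unfolded cmp_assoc]
        G_shift[THEN cmp_ctx, unfolded cmp_assoc] shift_cmp)
  have G_3: "arity 3 2 G"
    using arity_add[OF arity_G, of 1] by (simp add: numeral_3_eq_3 numeral_2_eq_2)
  have v: "arity 3 1 (G \<odot> G)"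
    by (intro arity_cmp[of 3 2] G_3 arity_G)
  have "arity 1 2 (bul ?D)"
    using arity_add[OF arity_bul, of 1] by (simp add: numeral_2_eq_2)
  then have "arity 1 1 (bul ?D \<odot> B)"
    by (rule arity_cmp[OF _ arity_B])
  with v have *: "arity 3 1 ((G \<odot> G) \<odot> bul ?D \<odot> B)"
    by (rule arity_cmp)
  have "arity 3 3 (\<sigma> ?C)"
    using arity_shift[OF arity_C] by (simp add: numeral_3_eq_3 numeral_2_eq_2)
  from arity_cmp[OF this *] have u: "arity 3 1 ?u"
    by (simp only: cmp_assoc)
  have "?u \<odot> B \<odot> B = \<sigma> ?C \<odot> G \<odot> G \<odot> (bul ?D \<odot> B \<odot> B \<odot> B)"
    by (simp add: cmp_assoc)
  also have "\<dots> = \<sigma> ?C \<odot> G \<odot> (G \<odot> \<sigma> ?D) \<odot> B \<odot> B"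
    using arityD[OF arity_C[of Minus]] by (simp add: numeral_2_eq_2 cmp_assoc)
  also have "\<dots> = \<sigma> ?C \<odot> \<sigma> (\<sigma> (\<sigma> ?D)) \<odot> (G \<odot> G \<odot> B \<odot> B)"
    by (simp only: G_shift G_shift[THEN cmp_ctx, unfolded cmp_assoc] cmp_assoc)
  also have "\<dots> = \<sigma> (?C \<odot> \<sigma> (\<sigma> ?D) \<odot> \<sigma> \<gamma> \<odot> \<gamma>)"
    by (simp only: GG shift_cmp cmp_assoc)
  also have "\<dots> = \<sigma> (\<sigma> \<gamma> \<odot> \<gamma>)"
    by (simp only: C_\<gamma>_\<gamma> C_cancel_simps[of Plus, unfolded opp.simps])
  also have "\<dots> = (G \<odot> G) \<odot> B \<odot> B"
    by (simp only: GG cmp_assoc)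
  finally have **: "(?u \<odot> B) \<odot> B = ((G \<odot> G) \<odot> B) \<odot> B"
    by (simp only: cmp_assoc)
  \<comment> \<open>Composing with \<open>B\<close> keeps a single output, so
    \<open>arity_eta\<close> can be used twice, removing one \<open>B\<close> each time.\<close>
  have *: "arity 4 1 (w \<odot> B)" if "arity 3 1 w" for w
    using arity_add[OF that, of 1] by (intro arity_cmp[of 4 2] arity_B) (simp add: numeral_2_eq_2)
  have "?u \<odot> B = (G \<odot> G) \<odot> B"
    by (rule arity_eta[OF *[OF u] *[OF v] **])
  then show ?thesis
    by (rule arity_eta[OF u v])
qed

text \<open>The positive crossing moves back to the nested cups, is rotated around them by
  \<open>\<alpha>_\<alpha>_C\<close>, and is then absorbed with the negative one by
  \<open>G_G_C\<close>.\<close>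

lemma tr_slide: "tr \<odot> tr \<odot> bul (C Minus) \<odot> B \<odot> \<sigma> (C Plus) = tr \<odot> tr"
proof -
  let ?C = "C Plus" and ?D = "C Minus"
  have tr2: "tr \<odot> tr = \<sigma> (\<alpha> \<odot> \<sigma> \<alpha>) \<odot> G \<odot> G"
    by (simp only: tr_def G_shift[THEN cmp_ctx, unfolded cmp_assoc] shift_cmp cmp_assoc)
  have "tr \<odot> tr \<odot> bul ?D \<odot> B \<odot> \<sigma> ?C = (tr \<odot> tr) \<odot> bul ?D \<odot> (B \<odot> \<sigma> ?C)"
    by (simp only: cmp_assoc)
  also have "\<dots> = \<sigma> (\<alpha> \<odot> \<sigma> \<alpha>) \<odot> G \<odot> G \<odot> (bul ?D \<odot> \<sigma> (\<sigma> ?C)) \<odot> B"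
    by (simp only: tr2 B_shift cmp_assoc)
  also have "\<dots> = \<sigma> (\<alpha> \<odot> \<sigma> \<alpha> \<odot> \<sigma> (\<sigma> ?C)) \<odot> G \<odot> G \<odot> bul ?D \<odot> B"
    by (simp only: bul_shift G_shift[THEN cmp_ctx, unfolded cmp_assoc] shift_cmp cmp_assoc)
  also have "\<dots> = \<sigma> (\<alpha> \<odot> \<sigma> \<alpha>) \<odot> (\<sigma> ?C \<odot> G \<odot> G \<odot> bul ?D \<odot> B)"
    by (simp only: \<alpha>_\<alpha>_C shift_cmp cmp_assoc)
  finally show ?thesis
    by (simp only: G_G_C tr2)
qed

lemma traced: "traced_extensional_BCI_algebra app B C I \<theta> tr"
proof unfold_locales
  show "(C s \<cdot> B \<cdot> tr) \<odot> B = \<sigma> tr \<odot> B \<up> 2" for s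
    using arityD[OF arity_tr] by (simp add: C_eq_bul cmp_assoc)
  show "\<sigma> tr \<odot> ((C s \<cdot> B \<cdot> B) \<odot> B) = B \<odot> tr" for s
    using tr_B by (simp add: C_eq_bul cmp_assoc)
  show "tr \<cdot> C p = \<theta> p" for p
    by (rule tr_C)
  show "tr \<up> 2 \<odot> ((C s \<cdot> B \<cdot> C Minus) \<odot> (B \<cdot> C Plus)) = tr \<up> 2" for s
    using tr_slide by (simp add: C_eq_bul numeral_2_eq_2 cmp_assoc)
qed

end

theorem theorem5p6:
  fixes app :: "'a \<Rightarrow> 'a \<Rightarrow> 'a"
    and B I :: 'a
    and C \<theta> :: "sign \<Rightarrow> 'a"
  assumes "balanced_extensional_BCI_algebra app B C I \<theta>"
  shows "(\<exists>Tr. traced_extensional_BCI_algebra app B C I \<theta> Tr) \<longleftrightarrow>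
         (\<exists>\<alpha> \<beta>. ribbon_extensional_BCI_algebra app B C I \<theta> \<alpha> \<beta>)"
proof
  assume "\<exists>Tr. traced_extensional_BCI_algebra app B C I \<theta> Tr"
  then obtain Tr where "traced_extensional_BCI_algebra app B C I \<theta> Tr" ..
  from traced_extensional_BCI_algebra.ribbon[OF this]
  show "\<exists>\<alpha> \<beta>. ribbon_extensional_BCI_algebra app B C I \<theta> \<alpha> \<beta>"
    by blast
next
  assume "\<exists>\<alpha> \<beta>. ribbon_extensional_BCI_algebra app B C I \<theta> \<alpha> \<beta>"
  then obtain \<alpha> \<beta> where "ribbon_extensional_BCI_algebra app B C I \<theta> \<alpha> \<beta>"
    by blast
  from ribbon_extensional_BCI_algebra.traced[OF this]
  show "\<exists>Tr. traced_extensional_BCI_algebra app B C I \<theta> Tr" ..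
qed

end
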